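(* Let $L$ be a Lie superalgebra whose Schur multiplier $\mathcal{M}(L)$ is of (finite) dimension $(m\mid n)$. Then all covers of $L$ are isoclinic to one another.
   Context: All vector superspaces are over a field $\mathbb{F}$ of characteristic different from $2$ and $3$. A Lie superalgebra is a $\mathbb{Z}_2$-graded vector space $L=L_{\bar 0}\oplus L_{\bar 1}$ with a bilinear bracket satisfying, for homogeneous elements, $[L_\alpha,L_\beta]\subseteq L_{\alpha+\beta}$, $[x,y]=-(-1)^{|x||y|}[y,x]$, and $(-1)^{|x||z|}[x,[y,z]]+(-1)^{|y||x|}[y,[z,x]]+(-1)^{|z||y|}[z,[x,y]]=0$. Homomorphisms are bracket-preserving linear maps of even degree (preserving the grading). $K^2=[K,K]$ is the span of all brackets and $Z(K)=\{z\in K:[z,x]=0\ \forall x\in K\}$. Dimension $(m\mid n)$ means that the even part has dimension $m$ and the odd part has dimension $n$, with $m,n$ finite. A free presentation of $L$ is a short exact sequence $0\to R\to F\to L\to 0$ of Lie superalgebras with $F$ a free Lie superalgebra on a $\mathbb{Z}_2$-graded set. The Schur multiplier of $L$ is $\mathcal{M}(L)=([F,F]\cap R)/[F,R]$; it is abelian and independent (up to isomorphism) of the free presentation. An extension of $L$ is a short exact sequence $0\to M\to K\xrightarrow{f} L\to 0$ of Lie superalgebras, with $M$ identified with $\ker f$. It is a stem extension if $M\subseteq Z(K)\cap K^2$. A stem extension is a stem cover if $M\cong\mathcal{M}(L)$, and in this case $K$ is called a cover of $L$. Two Lie superalgebras $L$ and $K$ are isoclinic if there are Lie superalgebra isomorphisms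 $\alpha: L/Z(L)\to K/Z(K)$ and $\beta: L^2\to K^2$ that are compatible: $\beta([l,m])=[k,r]$ whenever $l,m\in L$, $k,r\in K$ with $k+Z(K)=\alpha(l+Z(L))$ and $r+Z(K)=\alpha(m+Z(L))$. *)

theory Defs
  imports "HOL.Hull" "HOL-Algebra.Module" "HOL-Algebra.QuotRing" "HOL-Library.Z2"
begin

section \<open>Superalgebras and Lie superalgebras\<close>

text \<open>
  The vector spaces are modules in the sense of HOL-Algebra over a field given as a record.
  The product of an algebra is the field \<open>bracket\<close>; the components \<open>mult\<close> and \<open>one\<close>,
  inherited from the record of modules, are not used. The grading group is the type \<^typ>\<open>bit\<close>,
  the integers modulo 2, and \<open>part A a\<close> is the homogeneous component of degree \<open>a\<close>.
\<close>

record ('a, 'v) superalgebra = "('a, 'v) module" +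
  bracket :: "'v \<Rightarrow> 'v \<Rightarrow> 'v"  (\<open>\<langle>_,/ _\<rangle>\<index>\<close>)
  part :: "bit \<Rightarrow> 'v set"

text \<open>A \<open>\<int>\<^sub>2\<close>-graded algebra, neither associative nor skew-symmetric in general.\<close>

locale superalgebra = K?: field K + module K A
  for K (structure) and A (structure) +
  assumes part_submodule: "submodule (part A a) K A"
    and parts_span: "carrier A = part A 0 <+>\<^bsub>A\<^esub> part A 1"
    and parts_disjoint: "part A 0 \<inter> part A 1 = {\<zero>\<^bsub>A\<^esub>}"
    and bracket_closed: "\<lbrakk>x \<in> carrier A; y \<in> carrier A\<rbrakk> \<Longrightarrow> \<langle>x, y\<rangle>\<^bsub>A\<^esub> \<in> carrier A"
    and bracket_add_left: "\<lbrakk>x \<in> carrier A; y \<in> carrier A; z \<in> carrier A\<rbrakk> \<Longrightarrow>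
      \<langle>x \<oplus>\<^bsub>A\<^esub> y, z\<rangle>\<^bsub>A\<^esub> = \<langle>x, z\<rangle>\<^bsub>A\<^esub> \<oplus>\<^bsub>A\<^esub> \<langle>y, z\<rangle>\<^bsub>A\<^esub>"
    and bracket_add_right: "\<lbrakk>x \<in> carrier A; y \<in> carrier A; z \<in> carrier A\<rbrakk> \<Longrightarrow>
      \<langle>x, y \<oplus>\<^bsub>A\<^esub> z\<rangle>\<^bsub>A\<^esub> = \<langle>x, y\<rangle>\<^bsub>A\<^esub> \<oplus>\<^bsub>A\<^esub> \<langle>x, z\<rangle>\<^bsub>A\<^esub>"
    and bracket_smult_left: "\<lbrakk>c \<in> carrier K; x \<in> carrier A; y \<in> carrier A\<rbrakk> \<Longrightarrow>
      \<langle>c \<odot>\<^bsub>A\<^esub> x, y\<rangle>\<^bsub>A\<^esub> = c \<odot>\<^bsub>A\<^esub> \<langle>x, y\<rangle>\<^bsub>A\<^esub>"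
    and bracket_smult_right: "\<lbrakk>c \<in> carrier K; x \<in> carrier A; y \<in> carrier A\<rbrakk> \<Longrightarrow>
      \<langle>x, c \<odot>\<^bsub>A\<^esub> y\<rangle>\<^bsub>A\<^esub> = c \<odot>\<^bsub>A\<^esub> \<langle>x, y\<rangle>\<^bsub>A\<^esub>"
    and bracket_graded: "\<lbrakk>x \<in> part A a; y \<in> part A b\<rbrakk> \<Longrightarrow> \<langle>x, y\<rangle>\<^bsub>A\<^esub> \<in> part A (a + b)"

text \<open>\<open>koszul A a b x\<close> is \<open>(-1)\<^bsup>ab\<^esup> x\<close>.\<close>

definition koszul :: "('a, 'v, 'm) superalgebra_scheme \<Rightarrow> bit \<Rightarrow> bit \<Rightarrow> 'v \<Rightarrow> 'v" where
  "koszul A a b x = (if a * b = 1 then \<ominus>\<^bsub>A\<^esub> x else x)"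

definition super_jacobi ::
    "('a, 'v, 'm) superalgebra_scheme \<Rightarrow> bit \<Rightarrow> bit \<Rightarrow> bit \<Rightarrow> 'v \<Rightarrow> 'v \<Rightarrow> 'v \<Rightarrow> 'v" where
  "super_jacobi A a b c x y z =
     koszul A a c \<langle>x, \<langle>y, z\<rangle>\<^bsub>A\<^esub>\<rangle>\<^bsub>A\<^esub> \<oplus>\<^bsub>A\<^esub> koszul A b a \<langle>y, \<langle>z, x\<rangle>\<^bsub>A\<^esub>\<rangle>\<^bsub>A\<^esub> \<oplus>\<^bsub>A\<^esub> koszul A c b \<langle>z, \<langle>x, y\<rangle>\<^bsub>A\<^esub>\<rangle>\<^bsub>A\<^esub>"

locale lie_superalgebra = superalgebra K L for K (structure) and L (structure) +
  assumes super_skew: "\<lbrakk>x \<in> part L a; y \<in> part L b\<rbrakk> \<Longrightarrow>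
      \<langle>x, y\<rangle>\<^bsub>L\<^esub> = \<ominus>\<^bsub>L\<^esub> koszul L a b \<langle>y, x\<rangle>\<^bsub>L\<^esub>"
    and super_jacobi: "\<lbrakk>x \<in> part L a; y \<in> part L b; z \<in> part L c\<rbrakk> \<Longrightarrow>
      super_jacobi L a b c x y z = \<zero>\<^bsub>L\<^esub>"

definition superalgebra_hom ::
    "('a, 'k) ring_scheme \<Rightarrow> ('a, 'v, 'm) superalgebra_scheme \<Rightarrow> ('a, 'w, 'n) superalgebra_scheme
      \<Rightarrow> ('v \<Rightarrow> 'w) set" where
  "superalgebra_hom K A B = {f \<in> carrier A \<rightarrow> carrier B.
     (\<forall>x\<in>carrier A. \<forall>y\<in>carrier A. f (x \<oplus>\<^bsub>A\<^esub> y) = f x \<oplus>\<^bsub>B\<^esub> f y) \<and>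
     (\<forall>c\<in>carrier K. \<forall>x\<in>carrier A. f (c \<odot>\<^bsub>A\<^esub> x) = c \<odot>\<^bsub>B\<^esub> f x) \<and>
     (\<forall>a. f ` part A a \<subseteq> part B a) \<and>
     (\<forall>x\<in>carrier A. \<forall>y\<in>carrier A. f \<langle>x, y\<rangle>\<^bsub>A\<^esub> = \<langle>f x, f y\<rangle>\<^bsub>B\<^esub>)}"

definition superalgebra_iso ::
    "('a, 'k) ring_scheme \<Rightarrow> ('a, 'v, 'm) superalgebra_scheme \<Rightarrow> ('a, 'w, 'n) superalgebra_scheme
      \<Rightarrow> ('v \<Rightarrow> 'w) set" where
  "superalgebra_iso K A B = {f \<in> superalgebra_hom K A B. bij_betw f (carrier A) (carrier B)}"

section \<open>Subspaces, subalgebras and quotients\<close>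

definition lspan :: "('a, 'k) ring_scheme \<Rightarrow> ('a, 'v, 'm) module_scheme \<Rightarrow> 'v set \<Rightarrow> 'v set" where
  "lspan K V S = (\<lambda>H. submodule H K V) hull S"

definition has_dim ::
    "('a, 'k) ring_scheme \<Rightarrow> ('a, 'v, 'm) module_scheme \<Rightarrow> 'v set \<Rightarrow> nat \<Rightarrow> bool" where
  "has_dim K V W n \<longleftrightarrow> (\<exists>B \<subseteq> W. finite B \<and> card B = n \<and> lspan K V B = W \<and>
     (\<forall>c \<in> B \<rightarrow> carrier K. (\<Oplus>\<^bsub>V\<^esub>b\<in>B. c b \<odot>\<^bsub>V\<^esub> b) = \<zero>\<^bsub>V\<^esub> \<longrightarrow> (\<forall>b\<in>B. c b = \<zero>\<^bsub>K\<^esub>)))"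

definition has_superdim ::
    "('a, 'k) ring_scheme \<Rightarrow> ('a, 'v, 'm) superalgebra_scheme \<Rightarrow> nat \<Rightarrow> nat \<Rightarrow> bool" where
  "has_superdim K A m n \<longleftrightarrow> has_dim K A (part A 0) m \<and> has_dim K A (part A 1) n"

definition bracket_span ::
    "('a, 'k) ring_scheme \<Rightarrow> ('a, 'v, 'm) superalgebra_scheme \<Rightarrow> 'v set \<Rightarrow> 'v set \<Rightarrow> 'v set" where
  "bracket_span K A S T = lspan K A {\<langle>x, y\<rangle>\<^bsub>A\<^esub> |x y. x \<in> S \<and> y \<in> T}"

definition derived :: "('a, 'k) ring_scheme \<Rightarrow> ('a, 'v, 'm) superalgebra_scheme \<Rightarrow> 'v set" where
  "derived K A = bracket_span K A (carrier A) (carrier A)"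

definition lie_center :: "('a, 'v, 'm) superalgebra_scheme \<Rightarrow> 'v set" where
  "lie_center A = {z \<in> carrier A. \<forall>x\<in>carrier A. \<langle>z, x\<rangle>\<^bsub>A\<^esub> = \<zero>\<^bsub>A\<^esub>}"

text \<open>The graded subspace \<open>H\<close> of \<open>A\<close> as a superalgebra of its own.\<close>

definition restrict_to ::
    "('a, 'v, 'm) superalgebra_scheme \<Rightarrow> 'v set \<Rightarrow> ('a, 'v, 'm) superalgebra_scheme" where
  "restrict_to A H = A\<lparr>carrier := H, part := \<lambda>a. H \<inter> part A a\<rparr>"

text \<open>The quotient of \<open>A\<close> by a graded ideal \<open>I\<close>, with the additive cosets of \<open>I\<close> as elements
  (compare \<^const>\<open>FactRing\<close>).\<close>

definition superalgebra_quotient ::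
    "('a, 'v, 'm) superalgebra_scheme \<Rightarrow> 'v set \<Rightarrow> ('a, 'v set) superalgebra" where
  "superalgebra_quotient A I = \<lparr>carrier = a_rcosets\<^bsub>A\<^esub> I, mult = undefined, one = undefined,
     zero = I, add = set_add A,
     smult = (\<lambda>c S. \<Union>x\<in>S. I +>\<^bsub>A\<^esub> (c \<odot>\<^bsub>A\<^esub> x)),
     bracket = (\<lambda>S T. \<Union>x\<in>S. \<Union>y\<in>T. I +>\<^bsub>A\<^esub> \<langle>x, y\<rangle>\<^bsub>A\<^esub>),
     part = (\<lambda>a. (\<lambda>x. I +>\<^bsub>A\<^esub> x) ` part A a)\<rparr>"

section \<open>Free Lie superalgebras\<close>

text \<open>
  A \<open>\<int>\<^sub>2\<close>-graded set is a set \<open>X\<close> with a degree function \<open>d\<close>. The free Lie superalgebra on it is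
  the free nonassociative superalgebra, whose basis consists of all bracketings of elements
  of \<open>X\<close>, modulo the two-sided ideal generated by the defining identities of Lie superalgebras.
  A construction is used because the universal property quantifies over algebras of all types.
\<close>

datatype (letters: 'x) bracketing = Letter 'x | Bracketing "'x bracketing" "'x bracketing"

primrec degree :: "('x \<Rightarrow> bit) \<Rightarrow> 'x bracketing \<Rightarrow> bit" where
  "degree d (Letter x) = d x"
| "degree d (Bracketing s t) = degree d s + degree d t"

text \<open>The elements are the finitely supported families of coefficients of bracketings. As a
  bracketing decomposes in at most one way, each coefficient of a product is a single product
  of coefficients.\<close>

definition free_superalgebra ::
    "('a, 'k) ring_scheme \<Rightarrow> 'x set \<Rightarrow> ('x \<Rightarrow> bit) \<Rightarrow> ('a, 'x bracketing \<Rightarrow> 'a) superalgebra" where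
  "free_superalgebra K X d =
    (let V = {f. range f \<subseteq> carrier K \<and> finite {t. f t \<noteq> \<zero>\<^bsub>K\<^esub>} \<and>
                 (\<forall>t. f t \<noteq> \<zero>\<^bsub>K\<^esub> \<longrightarrow> letters t \<subseteq> X)}
     in \<lparr>carrier = V, mult = undefined, one = undefined,
         zero = (\<lambda>t. \<zero>\<^bsub>K\<^esub>), add = (\<lambda>f g t. f t \<oplus>\<^bsub>K\<^esub> g t), smult = (\<lambda>c f t. c \<otimes>\<^bsub>K\<^esub> f t),
         bracket = (\<lambda>f g t. case t of Letter x \<Rightarrow> \<zero>\<^bsub>K\<^esub> | Bracketing r s \<Rightarrow> f r \<otimes>\<^bsub>K\<^esub> g s),
         part = (\<lambda>a. {f \<in> V. \<forall>t. f t \<noteq> \<zero>\<^bsub>K\<^esub> \<longrightarrow> degree d t = a})\<rparr>)"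

definition two_sided_ideal ::
    "('a, 'k) ring_scheme \<Rightarrow> ('a, 'v, 'm) superalgebra_scheme \<Rightarrow> 'v set \<Rightarrow> bool" where
  "two_sided_ideal K A I \<longleftrightarrow> submodule I K A \<and>
     (\<forall>x\<in>carrier A. \<forall>y\<in>I. \<langle>x, y\<rangle>\<^bsub>A\<^esub> \<in> I \<and> \<langle>y, x\<rangle>\<^bsub>A\<^esub> \<in> I)"

definition lie_relators :: "('a, 'v, 'm) superalgebra_scheme \<Rightarrow> 'v set" where
  "lie_relators A =
     {\<langle>x, y\<rangle>\<^bsub>A\<^esub> \<oplus>\<^bsub>A\<^esub> koszul A a b \<langle>y, x\<rangle>\<^bsub>A\<^esub> |x y a b. x \<in> part A a \<and> y \<in> part A b} \<union>
     {super_jacobi A a b c x y z |x y z a b c. x \<in> part A a \<and> y \<in> part A b \<and> z \<in> part A c}"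

definition free_lie_superalgebra ::
    "('a, 'k) ring_scheme \<Rightarrow> 'x set \<Rightarrow> ('x \<Rightarrow> bit) \<Rightarrow> ('a, ('x bracketing \<Rightarrow> 'a) set) superalgebra" where
  "free_lie_superalgebra K X d =
    (let A = free_superalgebra K X d in superalgebra_quotient A (two_sided_ideal K A hull lie_relators A))"

definition is_free_on ::
    "('a, 'k) ring_scheme \<Rightarrow> ('a, 'f, 'm) superalgebra_scheme \<Rightarrow> 'x set \<Rightarrow> ('x \<Rightarrow> bit) \<Rightarrow> bool" where
  "is_free_on K F X d \<longleftrightarrow> lie_superalgebra K F \<and>
     superalgebra_iso K (free_lie_superalgebra K X d) F \<noteq> {}"

section \<open>Extensions, Schur multipliers, covers and isoclinism\<close>

text \<open>A short exact sequence \<open>0 \<rightarrow> M \<rightarrow> E \<rightarrow> L \<rightarrow> 0\<close> is given by \<open>f : E \<rightarrow> L\<close>, with \<open>M\<close> the kernel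
  of \<open>f\<close>.\<close>

definition is_extension ::
    "('a, 'k) ring_scheme \<Rightarrow> ('a, 'e, 'm) superalgebra_scheme \<Rightarrow> ('e \<Rightarrow> 'l)
      \<Rightarrow> ('a, 'l, 'n) superalgebra_scheme \<Rightarrow> bool" where
  "is_extension K E f L \<longleftrightarrow> lie_superalgebra K E \<and> lie_superalgebra K L \<and>
     f \<in> superalgebra_hom K E L \<and> f ` carrier E = carrier L"

definition is_free_presentation ::
    "('a, 'k) ring_scheme \<Rightarrow> 'x set \<Rightarrow> ('x \<Rightarrow> bit) \<Rightarrow> ('a, 'f, 'm) superalgebra_scheme \<Rightarrow> ('f \<Rightarrow> 'l)
      \<Rightarrow> ('a, 'l, 'n) superalgebra_scheme \<Rightarrow> bool" where
  "is_free_presentation K X d F p L \<longleftrightarrow> is_free_on K F X d \<and> is_extension K F p L"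

text \<open>\<open>([F,F] \<inter> R)/[F,R]\<close> for the presentation \<open>p : F \<rightarrow> L\<close> with kernel \<open>R\<close>.\<close>

definition schur_multiplier ::
    "('a, 'k) ring_scheme \<Rightarrow> ('a, 'f, 'm) superalgebra_scheme \<Rightarrow> ('f \<Rightarrow> 'l)
      \<Rightarrow> ('a, 'l, 'n) superalgebra_scheme \<Rightarrow> ('a, 'f set) superalgebra" where
  "schur_multiplier K F p L =
    (let R = a_kernel F L p
     in superalgebra_quotient (restrict_to F (derived K F \<inter> R)) (bracket_span K F (carrier F) R))"

definition is_stem_extension ::
    "('a, 'k) ring_scheme \<Rightarrow> ('a, 'e, 'm) superalgebra_scheme \<Rightarrow> ('e \<Rightarrow> 'l)
      \<Rightarrow> ('a, 'l, 'n) superalgebra_scheme \<Rightarrow> bool" where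
  "is_stem_extension K E f L \<longleftrightarrow> is_extension K E f L \<and>
     a_kernel E L f \<subseteq> lie_center E \<inter> derived K E"

text \<open>The argument \<open>M\<close> is the Schur multiplier of \<open>L\<close>, computed from some free presentation.\<close>

definition is_stem_cover ::
    "('a, 'k) ring_scheme \<Rightarrow> ('a, 'v, 'o) superalgebra_scheme \<Rightarrow> ('a, 'e, 'm) superalgebra_scheme
      \<Rightarrow> ('e \<Rightarrow> 'l) \<Rightarrow> ('a, 'l, 'n) superalgebra_scheme \<Rightarrow> bool" where
  "is_stem_cover K M E f L \<longleftrightarrow> is_stem_extension K E f L \<and>
     superalgebra_iso K (restrict_to E (a_kernel E L f)) M \<noteq> {}"

definition is_cover ::
    "('a, 'k) ring_scheme \<Rightarrow> ('a, 'v, 'o) superalgebra_scheme \<Rightarrow> ('a, 'e, 'm) superalgebra_scheme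
      \<Rightarrow> ('a, 'l, 'n) superalgebra_scheme \<Rightarrow> bool" where
  "is_cover K M E L \<longleftrightarrow> (\<exists>f. is_stem_cover K M E f L)"

definition isoclinic ::
    "('a, 'k) ring_scheme \<Rightarrow> ('a, 'v, 'm) superalgebra_scheme \<Rightarrow> ('a, 'w, 'n) superalgebra_scheme
      \<Rightarrow> bool" where
  "isoclinic K A B \<longleftrightarrow>
    (\<exists>\<alpha> \<in> superalgebra_iso K (superalgebra_quotient A (lie_center A)) (superalgebra_quotient B (lie_center B)).
     \<exists>\<beta> \<in> superalgebra_iso K (restrict_to A (derived K A)) (restrict_to B (derived K B)).
     \<forall>l\<in>carrier A. \<forall>m\<in>carrier A. \<forall>k\<in>carrier B. \<forall>r\<in>carrier B.
       lie_center B +>\<^bsub>B\<^esub> k = \<alpha> (lie_center A +>\<^bsub>A\<^esub> l) \<longrightarrow>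
       lie_center B +>\<^bsub>B\<^esub> r = \<alpha> (lie_center A +>\<^bsub>A\<^esub> m) \<longrightarrow>
       \<beta> \<langle>l, m\<rangle>\<^bsub>A\<^esub> = \<langle>k, r\<rangle>\<^bsub>B\<^esub>)"

end

(*  Let F -> L be a free presentation with kernel R. It lifts through every cover E -> L to a
    homomorphism phi from F to E. Since the kernel M of E -> L is central and contained in E^2,
    phi maps F onto E, phi maps
    F^2 \<inter> R onto M, and phi kills [F,R]. Hence phi induces a surjection of the Schur multiplier
    (F^2 \<inter> R)/[F,R] onto M, and M is isomorphic to the finite-dimensional multiplier, so
    this surjection is injective and ker phi \<inter> F^2 = [F,R]. The right-hand side does not depend
    on the cover: E^2 is F^2/[F,R], and the centre of E pulls back to
    {x. [x,F] \<subseteq> [F,R]}, so any two covers are isoclinic. *)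

theory Submission
  imports Defs
begin

section \<open>Graded subspaces\<close>

text \<open>The isomorphism in the definition of a stem cover is arbitrary: nothing relates it to
  the map that the lift induces on the multiplier. A surjection between isomorphic spaces can have a
  kernel when they are infinite-dimensional, and this is where the finite dimension enters.
  Composing the induced surjection with the given isomorphism yields a surjective endomorphism of
  the multiplier, so injectivity follows from a chain of kernels, with no comparison of dimensions.
  Two further matters shape the work. Freeness is given by a construction, so the lifting property
  has to be derived from it. Skew-symmetry holds for homogeneous elements only, so statements about
  arbitrary elements pass through their components, and each subspace used must contain the
  components of its elements. The quotient of \<open>F\<close> by the pulled-back centre and the
  quotient of its derived algebra by [F,R] are never formed. Both isomorphisms of the isoclinism
  come from two surjections with a common source and the same fibres.\<close>

lemma (in module) lspan_submodule:
  assumes "S \<subseteq> carrier M" shows "submodule (lspan R M S) R M"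
proof (rule submoduleI)
  \<comment> \<open>The hull is an intersection of submodules. Since \<open>S\<close> lies in the
    carrier, the carrier itself is a member of the family, so the intersection stays inside
    it.\<close>
  show "lspan R M S \<subseteq> carrier M"
    unfolding lspan_def using assms carrier_is_submodule by (rule hull_minimal)
  show "\<zero>\<^bsub>M\<^esub> \<in> lspan R M S"
    using subgroup.one_closed[OF submodule.axioms(1)] by (fastforce simp: lspan_def hull_def)
qed (auto simp: lspan_def hull_def intro: submoduleE)

section \<open>Linear rules in a graded algebra and spans of brackets\<close>

context superalgebra
begin

lemma part_closed: "x \<in> part A a \<Longrightarrow> x \<in> carrier A"
  using submoduleE(1)[OF part_submodule] by blast

lemma part_zero: "\<zero>\<^bsub>A\<^esub> \<in> part A a"
  using subgroup.one_closed[OF submodule.axioms(1)[OF part_submodule]] by simp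

lemma part_add: "\<lbrakk>x \<in> part A a; y \<in> part A a\<rbrakk> \<Longrightarrow> x \<oplus>\<^bsub>A\<^esub> y \<in> part A a"
  by (rule submoduleE(5)[OF part_submodule])

lemma part_smult: "\<lbrakk>c \<in> carrier K; x \<in> part A a\<rbrakk> \<Longrightarrow> c \<odot>\<^bsub>A\<^esub> x \<in> part A a"
  by (rule submoduleE(4)[OF part_submodule])

lemma parts_trivial: "\<lbrakk>x \<in> part A a; x \<in> part A (a + 1)\<rbrakk> \<Longrightarrow> x = \<zero>\<^bsub>A\<^esub>"
  using parts_disjoint by (cases a) auto

lemma bracket_zero_left: "x \<in> carrier A \<Longrightarrow> \<langle>\<zero>\<^bsub>A\<^esub>, x\<rangle>\<^bsub>A\<^esub> = \<zero>\<^bsub>A\<^esub>"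
  using bracket_smult_left[of "\<zero>\<^bsub>K\<^esub>" "\<zero>\<^bsub>A\<^esub>" x] by (simp add: bracket_closed)

lemma bracket_zero_right: "x \<in> carrier A \<Longrightarrow> \<langle>x, \<zero>\<^bsub>A\<^esub>\<rangle>\<^bsub>A\<^esub> = \<zero>\<^bsub>A\<^esub>"
  using bracket_smult_right[of "\<zero>\<^bsub>K\<^esub>" x "\<zero>\<^bsub>A\<^esub>"] by (simp add: bracket_closed)

lemma uminus_eq_smult: "x \<in> carrier A \<Longrightarrow> \<ominus>\<^bsub>A\<^esub> x = (\<ominus>\<^bsub>K\<^esub> \<one>\<^bsub>K\<^esub>) \<odot>\<^bsub>A\<^esub> x"
  using smult_l_minus[of "\<one>\<^bsub>K\<^esub>" x] by simp

lemma bracket_diff_left: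
  assumes "x \<in> carrier A" "y \<in> carrier A" "z \<in> carrier A"
  shows "\<langle>x \<ominus>\<^bsub>A\<^esub> y, z\<rangle>\<^bsub>A\<^esub> = \<langle>x, z\<rangle>\<^bsub>A\<^esub> \<ominus>\<^bsub>A\<^esub> \<langle>y, z\<rangle>\<^bsub>A\<^esub>"
  using assms unfolding a_minus_def[of A]
  by (simp add: uminus_eq_smult bracket_closed bracket_add_left bracket_smult_left)

lemma bracket_diff_right:
  assumes "x \<in> carrier A" "y \<in> carrier A" "z \<in> carrier A"
  shows "\<langle>x, y \<ominus>\<^bsub>A\<^esub> z\<rangle>\<^bsub>A\<^esub> = \<langle>x, y\<rangle>\<^bsub>A\<^esub> \<ominus>\<^bsub>A\<^esub> \<langle>x, z\<rangle>\<^bsub>A\<^esub>"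
  using assms unfolding a_minus_def[of A]
  by (simp add: uminus_eq_smult bracket_closed bracket_add_right bracket_smult_right)

lemma diff_eq_zero_iff: "\<lbrakk>x \<in> carrier A; y \<in> carrier A\<rbrakk> \<Longrightarrow> x \<ominus>\<^bsub>A\<^esub> y = \<zero>\<^bsub>A\<^esub> \<longleftrightarrow> x = y"
  by (metis M.minus_equality M.minus_minus M.r_neg M.a_inv_closed a_minus_def)

lemma submodule_zero: "submodule H K A \<Longrightarrow> \<zero>\<^bsub>A\<^esub> \<in> H"
  using subgroup.one_closed[OF submodule.axioms(1)] by fastforce

lemma submodule_diff: "\<lbrakk>submodule H K A; x \<in> H; y \<in> H\<rbrakk> \<Longrightarrow> x \<ominus>\<^bsub>A\<^esub> y \<in> H"
  by (simp add: a_minus_def submoduleE)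

lemma lspan_minimal: "\<lbrakk>S \<subseteq> H; submodule H K A\<rbrakk> \<Longrightarrow> lspan K A S \<subseteq> H"
  unfolding lspan_def by (rule hull_minimal)

lemma lspan_base: "x \<in> S \<Longrightarrow> x \<in> lspan K A S"
  unfolding lspan_def by (rule hull_inc)

lemma bracket_span_submodule:
  "\<lbrakk>S \<subseteq> carrier A; T \<subseteq> carrier A\<rbrakk> \<Longrightarrow> submodule (bracket_span K A S T) K A"
  unfolding bracket_span_def by (rule lspan_submodule) (auto intro!: bracket_closed)

lemma bracket_in_span: "\<lbrakk>x \<in> S; y \<in> T\<rbrakk> \<Longrightarrow> \<langle>x, y\<rangle>\<^bsub>A\<^esub> \<in> bracket_span K A S T"
  unfolding bracket_span_def by (rule lspan_base) blast

lemma bracket_span_minimal: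
  "\<lbrakk>\<And>x y. \<lbrakk>x \<in> S; y \<in> T\<rbrakk> \<Longrightarrow> \<langle>x, y\<rangle>\<^bsub>A\<^esub> \<in> H; submodule H K A\<rbrakk> \<Longrightarrow> bracket_span K A S T \<subseteq> H"
  unfolding bracket_span_def by (rule lspan_minimal) auto

end

section \<open>Homogeneous components and graded subspaces\<close>

text \<open>The grading is given by two subspaces and not by projections, hence the description. In
  the type of degrees \<open>a + 1\<close> is the other parity, so one formula serves both.\<close>

definition component :: "('a, 'v, 'm) superalgebra_scheme \<Rightarrow> bit \<Rightarrow> 'v \<Rightarrow> 'v" where
  "component A a x = (THE u. u \<in> part A a \<and> (\<exists>v\<in>part A (a + 1). x = u \<oplus>\<^bsub>A\<^esub> v))"

text \<open>Equivalent to \<open>H\<close> being the sum of its intersections with the two parts,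
  which is what \<open>restrict_to A H\<close> needs in order to be graded.\<close>

definition graded_subspace ::
    "('a, 'k) ring_scheme \<Rightarrow> ('a, 'v, 'm) superalgebra_scheme \<Rightarrow> 'v set \<Rightarrow> bool" where
  "graded_subspace K A H \<longleftrightarrow> submodule H K A \<and> (\<forall>x\<in>H. \<forall>a. component A a x \<in> H)"

context superalgebra
begin

text \<open>Two decompositions of the same element differ by an element that lies in both parts,
  since the difference of the degree \<open>a\<close> terms equals the difference of the other terms
  in reverse order. The parts meet in zero.\<close>

lemma component_eq:
  assumes "u \<in> part A a" "v \<in> part A (a + 1)"
  shows "component A a (u \<oplus>\<^bsub>A\<^esub> v) = u"
  unfolding component_def
proof (rule the_equality)
  show "u \<in> part A a \<and> (\<exists>w\<in>part A (a + 1). u \<oplus>\<^bsub>A\<^esub> v = u \<oplus>\<^bsub>A\<^esub> w)" using assms by blast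
next
  fix u' assume "u' \<in> part A a \<and> (\<exists>w\<in>part A (a + 1). u \<oplus>\<^bsub>A\<^esub> v = u' \<oplus>\<^bsub>A\<^esub> w)"
  then obtain w where u': "u' \<in> part A a" and w: "w \<in> part A (a + 1)"
    and eq: "u \<oplus>\<^bsub>A\<^esub> v = u' \<oplus>\<^bsub>A\<^esub> w" by blast
  note c = part_closed[OF assms(1)] part_closed[OF assms(2)] part_closed[OF u'] part_closed[OF w]
  have "u' \<ominus>\<^bsub>A\<^esub> u = (u' \<oplus>\<^bsub>A\<^esub> w) \<ominus>\<^bsub>A\<^esub> (u \<oplus>\<^bsub>A\<^esub> w)"
    using c by (simp add: a_minus_def M.minus_add M.a_ac M.r_neg M.r_neg2)
  also have "\<dots> = (u \<oplus>\<^bsub>A\<^esub> v) \<ominus>\<^bsub>A\<^esub> (u \<oplus>\<^bsub>A\<^esub> w)" by (simp only: eq)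
  also have "\<dots> = v \<ominus>\<^bsub>A\<^esub> w"
    using c by (simp add: a_minus_def M.minus_add M.a_lcomm[of u v] M.r_neg1 M.r_neg2 M.a_assoc)
  finally have "u' \<ominus>\<^bsub>A\<^esub> u = v \<ominus>\<^bsub>A\<^esub> w" .
  then have "u' \<ominus>\<^bsub>A\<^esub> u = \<zero>\<^bsub>A\<^esub>"
    using parts_trivial[of "u' \<ominus>\<^bsub>A\<^esub> u" a] submodule_diff[OF part_submodule u' assms(1)]
      submodule_diff[OF part_submodule assms(2) w] by simp
  then show "u' = u" using c by (simp add: diff_eq_zero_iff)
qed

lemma decompose:
  assumes "x \<in> carrier A"
  obtains u v where "u \<in> part A a" "v \<in> part A (a + 1)" "x = u \<oplus>\<^bsub>A\<^esub> v"
proof -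
  from assms parts_span obtain u v where "u \<in> part A 0" "v \<in> part A 1" "x = u \<oplus>\<^bsub>A\<^esub> v"
    unfolding set_add_defs by auto
  moreover from this have "x = v \<oplus>\<^bsub>A\<^esub> u" by (simp add: part_closed M.a_comm)
  ultimately show thesis using that by (cases a) auto
qed

lemma component_part: "x \<in> carrier A \<Longrightarrow> component A a x \<in> part A a"
  by (erule decompose[of x a]) (simp add: component_eq)

lemma component_closed: "x \<in> carrier A \<Longrightarrow> component A a x \<in> carrier A"
  by (rule part_closed[OF component_part])

lemma component_sum: "x \<in> carrier A \<Longrightarrow> component A a x \<oplus>\<^bsub>A\<^esub> component A (a + 1) x = x"
proof (erule decompose[of x a])
  fix u v assume uv: "u \<in> part A a" "v \<in> part A (a + 1)" "x = u \<oplus>\<^bsub>A\<^esub> v"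
  then have "x = v \<oplus>\<^bsub>A\<^esub> u" by (simp add: part_closed M.a_comm)
  moreover have "component A (a + 1) (v \<oplus>\<^bsub>A\<^esub> u) = v" using uv by (intro component_eq) (cases a; simp)+
  ultimately show ?thesis using component_eq[OF uv(1,2)] uv(3) by simp
qed

lemmas component_sums = component_sum[of _ 0, simplified] component_sum[of _ 1, simplified]

lemma component_of_part: "x \<in> part A b \<Longrightarrow> component A a x = (if a = b then x else \<zero>\<^bsub>A\<^esub>)"
proof -
  assume x: "x \<in> part A b"
  show ?thesis
  proof (cases "a = b")
    case True
    then show ?thesis using component_eq[of x a "\<zero>\<^bsub>A\<^esub>"] x by (simp add: part_zero part_closed)
  next
    case False
    then have "b = a + 1" by (cases a; cases b) auto
    then show ?thesis using component_eq[of "\<zero>\<^bsub>A\<^esub>" a x] x False by (simp add: part_zero part_closed)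
  qed
qed

lemma component_add:
  assumes "x \<in> carrier A" "y \<in> carrier A"
  shows "component A a (x \<oplus>\<^bsub>A\<^esub> y) = component A a x \<oplus>\<^bsub>A\<^esub> component A a y"
proof -
  let ?c = "component A"
  have "x \<oplus>\<^bsub>A\<^esub> y = (?c a x \<oplus>\<^bsub>A\<^esub> ?c (a+1) x) \<oplus>\<^bsub>A\<^esub> (?c a y \<oplus>\<^bsub>A\<^esub> ?c (a+1) y)"
    using assms by (cases a; simp add: component_sums)
  also have "\<dots> = (?c a x \<oplus>\<^bsub>A\<^esub> ?c a y) \<oplus>\<^bsub>A\<^esub> (?c (a+1) x \<oplus>\<^bsub>A\<^esub> ?c (a+1) y)"
    using assms by (simp add: M.a_ac component_closed)
  finally show ?thesis
    using assms component_eq[of "?c a x \<oplus>\<^bsub>A\<^esub> ?c a y" a "?c (a+1) x \<oplus>\<^bsub>A\<^esub> ?c (a+1) y"]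
    by (simp add: component_part part_add)
qed

lemma component_smult:
  assumes "c \<in> carrier K" "x \<in> carrier A"
  shows "component A a (c \<odot>\<^bsub>A\<^esub> x) = c \<odot>\<^bsub>A\<^esub> component A a x"
proof -
  let ?c = "component A"
  have "c \<odot>\<^bsub>A\<^esub> x = c \<odot>\<^bsub>A\<^esub> (?c a x \<oplus>\<^bsub>A\<^esub> ?c (a+1) x)"
    using assms by (cases a; simp add: component_sums)
  also have "\<dots> = c \<odot>\<^bsub>A\<^esub> ?c a x \<oplus>\<^bsub>A\<^esub> c \<odot>\<^bsub>A\<^esub> ?c (a+1) x"
    using assms by (simp add: smult_r_distr component_closed)
  finally show ?thesis
    using assms component_eq[of "c \<odot>\<^bsub>A\<^esub> ?c a x" a "c \<odot>\<^bsub>A\<^esub> ?c (a+1) x"]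
    by (simp add: component_part part_smult)
qed

lemma component_zero: "component A a \<zero>\<^bsub>A\<^esub> = \<zero>\<^bsub>A\<^esub>"
  using component_of_part[OF part_zero[of a], of a] by simp

lemma component_uminus:
  assumes "x \<in> carrier A"
  shows "component A a (\<ominus>\<^bsub>A\<^esub> x) = \<ominus>\<^bsub>A\<^esub> component A a x"
proof -
  have "component A a (\<ominus>\<^bsub>A\<^esub> x) \<oplus>\<^bsub>A\<^esub> component A a x = \<zero>\<^bsub>A\<^esub>"
    using assms component_add[of "\<ominus>\<^bsub>A\<^esub> x" x a] by (simp add: M.l_neg component_zero)
  then show ?thesis using assms by (simp add: M.minus_equality component_closed)
qed

text \<open>Bracketing with a homogeneous element shifts all degrees by the same amount, so each
  component of the bracket comes from a single component of \<open>x\<close>. Gradedness of bracket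
  spans and of the centre both rest on this.\<close>

lemma component_bracket_part:
  assumes "x \<in> carrier A" "y \<in> part A b"
  shows "component A (a + b) \<langle>x, y\<rangle>\<^bsub>A\<^esub> = \<langle>component A a x, y\<rangle>\<^bsub>A\<^esub>"
proof -
  let ?u = "component A a x" and ?v = "component A (a + 1) x"
  have "\<langle>x, y\<rangle>\<^bsub>A\<^esub> = \<langle>?u \<oplus>\<^bsub>A\<^esub> ?v, y\<rangle>\<^bsub>A\<^esub>" using assms by (cases a; simp add: component_sums)
  also have "\<dots> = \<langle>?u, y\<rangle>\<^bsub>A\<^esub> \<oplus>\<^bsub>A\<^esub> \<langle>?v, y\<rangle>\<^bsub>A\<^esub>"
    using assms by (simp add: bracket_add_left component_closed part_closed)
  moreover have "\<langle>?v, y\<rangle>\<^bsub>A\<^esub> \<in> part A (a + b + 1)"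
    using bracket_graded[OF component_part[OF assms(1), of "a+1"] assms(2)]
    by (cases a; cases b; simp)
  ultimately show ?thesis
    using component_eq bracket_graded[OF component_part[OF assms(1), of a] assms(2)] by simp
qed

lemma graded_subspaceI:
  "\<lbrakk>submodule H K A; \<And>x a. x \<in> H \<Longrightarrow> component A a x \<in> H\<rbrakk> \<Longrightarrow> graded_subspace K A H"
  by (simp add: graded_subspace_def)

lemma graded_subspace_carrier: "graded_subspace K A (carrier A)"
  by (simp add: graded_subspaceI carrier_is_submodule component_closed)

lemma submodule_Int: "\<lbrakk>submodule G K A; submodule H K A\<rbrakk> \<Longrightarrow> submodule (G \<inter> H) K A"
  by (rule submoduleI) (use submoduleE in \<open>auto simp: submodule_zero\<close>)

lemma graded_subspace_Int:
  "\<lbrakk>graded_subspace K A G; graded_subspace K A H\<rbrakk> \<Longrightarrow> graded_subspace K A (G \<inter> H)"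
  by (simp add: graded_subspace_def submodule_Int)

lemma graded_subspace_bracket_span:
  assumes "graded_subspace K A S" "graded_subspace K A T"
  shows "graded_subspace K A (bracket_span K A S T)" (is "graded_subspace K A ?B")
proof -
  have S: "S \<subseteq> carrier A" and T: "T \<subseteq> carrier A"
    using assms by (simp_all add: graded_subspace_def submoduleE)
  have B: "submodule ?B K A" using S T by (rule bracket_span_submodule)
  \<comment> \<open>Having all components in the span is a linear condition, so it suffices to check
    it on the generating brackets.\<close>
  let ?W = "{x \<in> carrier A. \<forall>a. component A a x \<in> ?B}"
  have "submodule ?W K A"
    by (rule submoduleI)
      (auto simp: component_zero component_uminus component_add component_smult submodule_zero[OF B]
        intro: submoduleE[OF B])
  moreover have "\<langle>x, y\<rangle>\<^bsub>A\<^esub> \<in> ?W" if x: "x \<in> S" and y: "y \<in> T" for x y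
  proof -
    have c: "x \<in> carrier A" "y \<in> carrier A" using x y S T by auto
    have "component A a \<langle>x, y\<rangle>\<^bsub>A\<^esub> \<in> ?B" for a
    proof -
      have 1: "component A a \<langle>x, component A b y\<rangle>\<^bsub>A\<^esub> \<in> ?B" for b
      proof -
        \<comment> \<open>Degrees are added modulo 2, so \<open>a = (a + b) + b\<close>: the part of
          \<open>x\<close> that contributes has degree \<open>a + b\<close>. It remains in
          \<open>S\<close> because \<open>S\<close> is graded, and likewise for \<open>y\<close> and
          \<open>T\<close>.\<close>
        have "component A a \<langle>x, component A b y\<rangle>\<^bsub>A\<^esub>
            = \<langle>component A (a + b) x, component A b y\<rangle>\<^bsub>A\<^esub>"
          using component_bracket_part[OF c(1) component_part[OF c(2), of b], of "a + b"]
          by (cases a; cases b; simp)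
        moreover have "component A (a + b) x \<in> S" "component A b y \<in> T"
          using assms x y by (simp_all add: graded_subspace_def)
        ultimately show ?thesis by (simp add: bracket_in_span)
      qed
      have "\<langle>x, y\<rangle>\<^bsub>A\<^esub> = \<langle>x, component A 0 y\<rangle>\<^bsub>A\<^esub> \<oplus>\<^bsub>A\<^esub> \<langle>x, component A 1 y\<rangle>\<^bsub>A\<^esub>"
        using c component_sum[OF c(2), of 0]
          bracket_add_right[OF c(1) component_closed[OF c(2)] component_closed[OF c(2)], of 0 1] by simp
      then have "component A a \<langle>x, y\<rangle>\<^bsub>A\<^esub> = component A a \<langle>x, component A 0 y\<rangle>\<^bsub>A\<^esub>
          \<oplus>\<^bsub>A\<^esub> component A a \<langle>x, component A 1 y\<rangle>\<^bsub>A\<^esub>"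
        using c by (simp add: component_add bracket_closed component_closed)
      then show ?thesis using submoduleE(5)[OF B 1 1] by simp
    qed
    then show ?thesis using c by (simp add: bracket_closed)
  qed
  ultimately have "?B \<subseteq> ?W" by (intro bracket_span_minimal)
  then show ?thesis using B by (auto intro: graded_subspaceI)
qed

lemma superalgebra_restrict_to:
  assumes "graded_subspace K A H" and br: "\<And>x y. \<lbrakk>x \<in> H; y \<in> H\<rbrakk> \<Longrightarrow> \<langle>x, y\<rangle>\<^bsub>A\<^esub> \<in> H"
  shows "superalgebra K (restrict_to A H)"
proof -
  have H: "submodule H K A" and comp: "\<And>x a. x \<in> H \<Longrightarrow> component A a x \<in> H"
    using assms(1) by (simp_all add: graded_subspace_def)
  have HA: "x \<in> H \<Longrightarrow> x \<in> carrier A" for x using submoduleE(1)[OF H] by blast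
  have "module K (A\<lparr>carrier := H\<rparr>)"
    by (rule submodule.submodule_is_module[OF H]) unfold_locales
  \<comment> \<open>This record differs from \<open>A\<lparr>carrier := H\<rparr>\<close> only in
    \<open>part\<close>, which the module axioms do not mention.\<close>
  then have mod: "module K (restrict_to A H)"
    by (simp add: module_def abelian_group_def abelian_monoid_def abelian_group_axioms_def
        module_axioms_def restrict_to_def a_inv_def)
  then interpret r: module K "restrict_to A H" .
  have sub: "submodule (H \<inter> part A a) K (restrict_to A H)" for a
  proof (rule r.module_incl_imp_submodule)
    have "submodule (H \<inter> part A a) K A" using H part_submodule by (rule submodule_Int)
    then have "module K (A\<lparr>carrier := H \<inter> part A a\<rparr>)"
      by (rule submodule.submodule_is_module) unfold_locales
    then show "module K (restrict_to A H\<lparr>carrier := H \<inter> part A a\<rparr>)"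
      by (simp add: module_def abelian_group_def abelian_monoid_def abelian_group_axioms_def
          module_axioms_def restrict_to_def a_inv_def)
  qed (simp add: restrict_to_def)
  show ?thesis
  proof (intro superalgebra.intro superalgebra_axioms.intro)
    show "field K" by unfold_locales
    show "module K (restrict_to A H)" by (rule mod)
    show "submodule (part (restrict_to A H) a) K (restrict_to A H)" for a
      using sub[of a] by (simp add: restrict_to_def)
    show "carrier (restrict_to A H)
        = part (restrict_to A H) 0 <+>\<^bsub>restrict_to A H\<^esub> part (restrict_to A H) 1"
    proof (rule Set.set_eqI)
      fix x
      have "x \<in> H \<longleftrightarrow> (\<exists>u\<in>H \<inter> part A 0. \<exists>v\<in>H \<inter> part A 1. x = u \<oplus>\<^bsub>A\<^esub> v)"
      proof
        assume x: "x \<in> H"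
        then show "\<exists>u\<in>H \<inter> part A 0. \<exists>v\<in>H \<inter> part A 1. x = u \<oplus>\<^bsub>A\<^esub> v"
          \<comment> \<open>Gradedness enters here: the two components of \<open>x\<close> provide
            the decomposition and lie in \<open>H\<close> themselves.\<close>
          using component_sum[OF HA[OF x], of 0] component_part[OF HA[OF x]] comp[OF x]
          by (metis IntI add_0)
      qed (auto intro: submoduleE[OF H])
      then show "x \<in> carrier (restrict_to A H)
          \<longleftrightarrow> x \<in> part (restrict_to A H) 0 <+>\<^bsub>restrict_to A H\<^esub> part (restrict_to A H) 1"
        by (simp add: restrict_to_def set_add_defs)
    qed
    show "part (restrict_to A H) 0 \<inter> part (restrict_to A H) 1 = {\<zero>\<^bsub>restrict_to A H\<^esub>}"
      using parts_disjoint submodule_zero[OF H] by (auto simp: restrict_to_def)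
    show "\<langle>x, y\<rangle>\<^bsub>restrict_to A H\<^esub> \<in> part (restrict_to A H) (a + b)"
      if "x \<in> part (restrict_to A H) a" "y \<in> part (restrict_to A H) b" for x y a b
      using that bracket_graded[of x a y b] br by (simp add: restrict_to_def)
  qed (simp_all add: restrict_to_def br HA bracket_add_left bracket_add_right bracket_smult_left
      bracket_smult_right)
qed

end

section \<open>Homomorphisms and quotients\<close>

lemma superalgebra_homI:
  assumes "\<And>x. x \<in> carrier A \<Longrightarrow> h x \<in> carrier B"
    and "\<And>x y. \<lbrakk>x \<in> carrier A; y \<in> carrier A\<rbrakk> \<Longrightarrow> h (x \<oplus>\<^bsub>A\<^esub> y) = h x \<oplus>\<^bsub>B\<^esub> h y"
    and "\<And>c x. \<lbrakk>c \<in> carrier K; x \<in> carrier A\<rbrakk> \<Longrightarrow> h (c \<odot>\<^bsub>A\<^esub> x) = c \<odot>\<^bsub>B\<^esub> h x"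
    and "\<And>x a. x \<in> part A a \<Longrightarrow> h x \<in> part B a"
    and "\<And>x y. \<lbrakk>x \<in> carrier A; y \<in> carrier A\<rbrakk> \<Longrightarrow> h \<langle>x, y\<rangle>\<^bsub>A\<^esub> = \<langle>h x, h y\<rangle>\<^bsub>B\<^esub>"
  shows "h \<in> superalgebra_hom K A B"
  using assms unfolding superalgebra_hom_def by auto

lemma
  assumes "h \<in> superalgebra_hom K A B"
  shows hom_closed: "x \<in> carrier A \<Longrightarrow> h x \<in> carrier B"
    and hom_add: "\<lbrakk>x \<in> carrier A; y \<in> carrier A\<rbrakk> \<Longrightarrow> h (x \<oplus>\<^bsub>A\<^esub> y) = h x \<oplus>\<^bsub>B\<^esub> h y"
    and hom_smult: "\<lbrakk>c \<in> carrier K; x \<in> carrier A\<rbrakk> \<Longrightarrow> h (c \<odot>\<^bsub>A\<^esub> x) = c \<odot>\<^bsub>B\<^esub> h x"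
    and hom_part: "x \<in> part A a \<Longrightarrow> h x \<in> part B a"
    and hom_bracket: "\<lbrakk>x \<in> carrier A; y \<in> carrier A\<rbrakk> \<Longrightarrow> h \<langle>x, y\<rangle>\<^bsub>A\<^esub> = \<langle>h x, h y\<rangle>\<^bsub>B\<^esub>"
  using assms unfolding superalgebra_hom_def by (simp_all add: Pi_iff image_subset_iff)

lemma superalgebra_hom_compose:
  assumes f: "f \<in> superalgebra_hom K A B" and g: "g \<in> superalgebra_hom K B C"
  shows "(\<lambda>x. g (f x)) \<in> superalgebra_hom K A C"
  by (rule superalgebra_homI)
    (simp_all add: hom_closed[OF f] hom_closed[OF g] hom_add[OF f] hom_add[OF g]
      hom_smult[OF f] hom_smult[OF g] hom_part[OF f] hom_part[OF g] hom_bracket[OF f] hom_bracket[OF g])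

text \<open>The module laws pass to the image of any surjection that respects the operations,
  negatives being images of negatives. The quotient thus becomes a module without any calculation
  with cosets.\<close>

lemma (in module) module_surjective_image:
  fixes Q :: "('a, 'w, 'n) module_scheme" and h
  assumes surj: "h ` carrier M = carrier Q"
    and add: "\<And>x y. \<lbrakk>x \<in> carrier M; y \<in> carrier M\<rbrakk> \<Longrightarrow> h (x \<oplus>\<^bsub>M\<^esub> y) = h x \<oplus>\<^bsub>Q\<^esub> h y"
    and smult: "\<And>c x. \<lbrakk>c \<in> carrier R; x \<in> carrier M\<rbrakk> \<Longrightarrow> h (c \<odot>\<^bsub>M\<^esub> x) = c \<odot>\<^bsub>Q\<^esub> h x"
    and zero: "\<zero>\<^bsub>Q\<^esub> = h \<zero>\<^bsub>M\<^esub>"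
  shows "module R Q"
proof (rule moduleI)
  have Q: "x \<in> carrier Q \<longleftrightarrow> (\<exists>y\<in>carrier M. x = h y)" for x
    unfolding surj[symmetric] by (rule image_iff)
  have closed: "h x \<in> carrier Q" if "x \<in> carrier M" for x using that Q by blast
  show "cring R" by (rule cring_axioms)
  show "abelian_group Q"
  proof (rule abelian_groupI)
    show "\<exists>y\<in>carrier Q. y \<oplus>\<^bsub>Q\<^esub> x = \<zero>\<^bsub>Q\<^esub>" if "x \<in> carrier Q" for x
    proof -
      obtain u where u: "u \<in> carrier M" "x = h u" using \<open>x \<in> carrier Q\<close> Q by blast
      then have "h (\<ominus>\<^bsub>M\<^esub> u) \<oplus>\<^bsub>Q\<^esub> x = \<zero>\<^bsub>Q\<^esub>" by (simp add: zero M.l_neg flip: add)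
      then show ?thesis using closed[of "\<ominus>\<^bsub>M\<^esub> u"] u(1) by blast
    qed
  qed (auto simp: Q zero M.a_assoc simp flip: add intro: M.a_comm intro!: arg_cong[of _ _ h])
qed (auto simp: smult_l_distr smult_r_distr smult_assoc1 simp flip: add smult surj)

text \<open>\<open>B\<close> and \<open>C\<close> are mere records: all laws are transported from
  \<open>A\<close> along \<open>f\<close>, so a quotient can be the target before anything is known
  of its structure. The hypothesis on parts provides homogeneous preimages, from which the induced
  map inherits its even degree.\<close>

lemma (in superalgebra) hom_factor:
  assumes f: "f \<in> superalgebra_hom K A B" and g: "g \<in> superalgebra_hom K A C"
    and surj: "f ` carrier A = carrier B" and part_surj: "\<And>a. part B a \<subseteq> f ` part A a"
    and fib: "\<And>x y. \<lbrakk>x \<in> carrier A; y \<in> carrier A; f x = f y\<rbrakk> \<Longrightarrow> g x = g y"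
  obtains h where "h \<in> superalgebra_hom K B C" "\<And>x. x \<in> carrier A \<Longrightarrow> h (f x) = g x"
proof
  define h where "h = (\<lambda>y. g (inv_into (carrier A) f y))"
  show hf: "h (f x) = g x" if "x \<in> carrier A" for x
    unfolding h_def using that by (intro fib inv_into_into f_inv_into_f) auto
  show "h \<in> superalgebra_hom K B C"
  proof (rule superalgebra_homI)
    fix y assume "y \<in> carrier B"
    then obtain x where x: "x \<in> carrier A" and y: "y = f x" using surj by blast
    show "h y \<in> carrier C" unfolding y hf[OF x] by (rule hom_closed[OF g x])
    show "h (c \<odot>\<^bsub>B\<^esub> y) = c \<odot>\<^bsub>C\<^esub> h y" if c: "c \<in> carrier K" for c
      unfolding y using c x hom_smult[OF f c x] hf[of "c \<odot>\<^bsub>A\<^esub> x"] by (simp add: hf hom_smult[OF g])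
    fix y' assume "y' \<in> carrier B"
    then obtain x' where x': "x' \<in> carrier A" and y': "y' = f x'" using surj by blast
    show "h (y \<oplus>\<^bsub>B\<^esub> y') = h y \<oplus>\<^bsub>C\<^esub> h y'"
      unfolding y y' using x x' hom_add[OF f x x'] hf[of "x \<oplus>\<^bsub>A\<^esub> x'"] by (simp add: hf hom_add[OF g])
    show "h \<langle>y, y'\<rangle>\<^bsub>B\<^esub> = \<langle>h y, h y'\<rangle>\<^bsub>C\<^esub>"
      unfolding y y' using x x' hom_bracket[OF f x x'] hf[of "\<langle>x, x'\<rangle>\<^bsub>A\<^esub>"]
      by (simp add: hf hom_bracket[OF g] bracket_closed)
  next
    fix y a assume "y \<in> part B a"
    then obtain x where x: "x \<in> part A a" and y: "y = f x" using part_surj by blast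
    then show "h y \<in> part C a" by (simp add: hf part_closed hom_part[OF g])
  qed
qed

text \<open>The tool behind both maps of an isoclinism: equal fibres make the induced map well
  defined in one direction and injective in the other.\<close>

lemma (in superalgebra) iso_factor:
  assumes f: "f \<in> superalgebra_hom K A B" and g: "g \<in> superalgebra_hom K A C"
    and "f ` carrier A = carrier B" and "\<And>a. part B a \<subseteq> f ` part A a"
    and "g ` carrier A = carrier C"
    and fib: "\<And>x y. \<lbrakk>x \<in> carrier A; y \<in> carrier A\<rbrakk> \<Longrightarrow> f x = f y \<longleftrightarrow> g x = g y"
  obtains h where "h \<in> superalgebra_iso K B C" "\<And>x. x \<in> carrier A \<Longrightarrow> h (f x) = g x"
proof -
  obtain h where h: "h \<in> superalgebra_hom K B C" and hf: "\<And>x. x \<in> carrier A \<Longrightarrow> h (f x) = g x"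
    using hom_factor[OF f g assms(3,4)] fib by metis
  have "bij_betw h (carrier B) (carrier C)"
    unfolding bij_betw_def inj_on_def assms(3,5)[symmetric] by (auto simp: image_image hf fib)
  then show thesis using that h hf by (simp add: superalgebra_iso_def)
qed

locale superalgebra_homomorphism = dom: superalgebra K A + cod: superalgebra K B
  for K (structure) and A (structure) and B (structure) and h +
  assumes hom: "h \<in> superalgebra_hom K A B"
begin

lemmas h_closed = hom_closed[OF hom] and h_add = hom_add[OF hom] and h_smult = hom_smult[OF hom]
  and h_part = hom_part[OF hom] and h_bracket = hom_bracket[OF hom]

lemma h_zero: "h \<zero>\<^bsub>A\<^esub> = \<zero>\<^bsub>B\<^esub>"
  using h_smult[of "\<zero>\<^bsub>K\<^esub>" "\<zero>\<^bsub>A\<^esub>"] by (simp add: h_closed)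

lemma h_uminus: "x \<in> carrier A \<Longrightarrow> h (\<ominus>\<^bsub>A\<^esub> x) = \<ominus>\<^bsub>B\<^esub> h x"
  using h_add[of "\<ominus>\<^bsub>A\<^esub> x" x] by (simp add: dom.M.l_neg h_zero cod.M.minus_equality h_closed)

lemma h_diff: "\<lbrakk>x \<in> carrier A; y \<in> carrier A\<rbrakk> \<Longrightarrow> h (x \<ominus>\<^bsub>A\<^esub> y) = h x \<ominus>\<^bsub>B\<^esub> h y"
  by (simp add: a_minus_def h_add h_uminus)

lemma h_eq_iff: "\<lbrakk>x \<in> carrier A; y \<in> carrier A\<rbrakk> \<Longrightarrow> h x = h y \<longleftrightarrow> h (x \<ominus>\<^bsub>A\<^esub> y) = \<zero>\<^bsub>B\<^esub>"
  by (simp add: h_diff cod.diff_eq_zero_iff h_closed)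

lemma h_component: 
  assumes "x \<in> carrier A" shows "h (component A a x) = component B a (h x)"
proof -
  have "h x = h (component A a x) \<oplus>\<^bsub>B\<^esub> h (component A (a + 1) x)"
    using assms dom.component_sum[of x a] h_add dom.component_closed by metis
  then show ?thesis
    using cod.component_eq h_part dom.component_part assms by metis
qed

lemma kernel_eq: "a_kernel A B h = {x \<in> carrier A. h x = \<zero>\<^bsub>B\<^esub>}"
  by (simp add: a_kernel_def kernel_def)

lemma kernel_submodule: "submodule (a_kernel A B h) K A"
  by (rule dom.submoduleI) (auto simp: kernel_eq h_zero h_uminus h_add h_smult)

lemma kernel_graded: "graded_subspace K A (a_kernel A B h)"
  by (rule dom.graded_subspaceI[OF kernel_submodule])
    (simp add: kernel_eq h_component dom.component_closed cod.component_zero)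

text \<open>A preimage of a homogeneous element need not be homogeneous, but its component of the
  right degree is again a preimage, because \<open>h\<close> commutes with taking
  components.\<close>

lemma part_surj:
  assumes "h ` carrier A = carrier B" shows "part B a \<subseteq> h ` part A a"
proof
  fix y assume y: "y \<in> part B a"
  then obtain x where x: "x \<in> carrier A" "y = h x" using assms cod.part_closed by blast
  then have "y = h (component A a x)" using y by (simp add: h_component cod.component_of_part)
  then show "y \<in> h ` part A a" using dom.component_part[OF x(1)] by blast
qed

lemma image_submodule:
  assumes "submodule H K A" shows "submodule (h ` H) K B"
proof (rule cod.submoduleI)
  note H = dom.submoduleE[OF assms]
  have c: "x \<in> H \<Longrightarrow> x \<in> carrier A" for x using H(1) by blast
  show "h ` H \<subseteq> carrier B" using c h_closed by blast
  show "\<zero>\<^bsub>B\<^esub> \<in> h ` H" using dom.submodule_zero[OF assms] h_zero by (metis imageI)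
  show "\<ominus>\<^bsub>B\<^esub> y \<in> h ` H" if "y \<in> h ` H" for y
    using that by (auto simp: c H(3) simp flip: h_uminus)
  show "y \<oplus>\<^bsub>B\<^esub> z \<in> h ` H" if "y \<in> h ` H" "z \<in> h ` H" for y z
    using that by (auto simp: c H(5) simp flip: h_add)
  show "k \<odot>\<^bsub>B\<^esub> y \<in> h ` H" if "k \<in> carrier K" "y \<in> h ` H" for k y
    using that by (auto simp: c H(4) simp flip: h_smult)
qed

end

section \<open>The derived algebra, cosets and quotients by ideals\<close>

context superalgebra
begin

lemma derived_submodule: "submodule (derived K A) K A"
  unfolding derived_def by (rule bracket_span_submodule) auto

lemma derived_closed: "x \<in> derived K A \<Longrightarrow> x \<in> carrier A"
  using submoduleE(1)[OF derived_submodule] by blast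

lemma bracket_in_derived: "\<lbrakk>x \<in> carrier A; y \<in> carrier A\<rbrakk> \<Longrightarrow> \<langle>x, y\<rangle>\<^bsub>A\<^esub> \<in> derived K A"
  unfolding derived_def by (rule bracket_in_span)

lemma derived_graded: "graded_subspace K A (derived K A)"
  unfolding derived_def by (intro graded_subspace_bracket_span graded_subspace_carrier)

lemma superalgebra_restrict_derived: "superalgebra K (restrict_to A (derived K A))"
  by (intro superalgebra_restrict_to derived_graded bracket_in_derived derived_closed)

lemma mem_coset_iff:
  assumes "submodule I K A" "x \<in> carrier A" "y \<in> carrier A"
  shows "y \<in> I +>\<^bsub>A\<^esub> x \<longleftrightarrow> y \<ominus>\<^bsub>A\<^esub> x \<in> I"
proof
  have I: "z \<in> I \<Longrightarrow> z \<in> carrier A" for z using submoduleE(1)[OF assms(1)] by blast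
  show "y \<ominus>\<^bsub>A\<^esub> x \<in> I" if "y \<in> I +>\<^bsub>A\<^esub> x"
    using that assms I by (auto simp: a_r_coset_def' a_minus_def M.a_assoc M.r_neg)
  show "y \<in> I +>\<^bsub>A\<^esub> x" if "y \<ominus>\<^bsub>A\<^esub> x \<in> I"
    using that assms(2,3) by (auto simp: a_r_coset_def' a_minus_def M.a_assoc M.l_neg intro!: bexI[of _ "y \<ominus>\<^bsub>A\<^esub> x"])
qed

lemma coset_eq_iff:
  assumes "submodule I K A" "x \<in> carrier A" "y \<in> carrier A"
  shows "I +>\<^bsub>A\<^esub> x = I +>\<^bsub>A\<^esub> y \<longleftrightarrow> x \<ominus>\<^bsub>A\<^esub> y \<in> I"
proof -
  interpret I: abelian_subgroup I A
    by (rule abelian_subgroupI3[OF additive_subgroup.intro[OF submodule.axioms(1)[OF assms(1)]]]) unfold_locales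
  have "x \<in> I +>\<^bsub>A\<^esub> x" using I.a_rcos_self assms(2) by simp
  moreover have "x \<in> I +>\<^bsub>A\<^esub> y \<Longrightarrow> I +>\<^bsub>A\<^esub> x = I +>\<^bsub>A\<^esub> y"
    by (rule M.a_repr_independence[OF _ assms(3) submodule.axioms(1)[OF assms(1)], symmetric])
  ultimately show ?thesis using mem_coset_iff[OF assms(1,3,2)] by auto
qed

text \<open>Operations on the quotient are unions over all representatives. When \<open>g\<close>
  respects congruence modulo \<open>I\<close>, all members of the union are the same coset, so it
  collapses to the value at one representative.\<close>

lemma coset_image_Union:
  assumes "submodule I K A" "x \<in> carrier A" "g x \<in> carrier A"
    and "\<And>y. \<lbrakk>y \<in> carrier A; y \<ominus>\<^bsub>A\<^esub> x \<in> I\<rbrakk> \<Longrightarrow> g y \<in> carrier A \<and> g y \<ominus>\<^bsub>A\<^esub> g x \<in> I"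
  shows "(\<Union>y\<in>I +>\<^bsub>A\<^esub> x. I +>\<^bsub>A\<^esub> (g y)) = I +>\<^bsub>A\<^esub> (g x)"
proof -
  have sub: "I +>\<^bsub>A\<^esub> x \<subseteq> carrier A"
    using a_r_coset_subset_G[OF submoduleE(1)[OF assms(1)] assms(2)] by simp
  have "I +>\<^bsub>A\<^esub> g y = I +>\<^bsub>A\<^esub> g x" if "y \<in> I +>\<^bsub>A\<^esub> x" for y
    using that sub assms mem_coset_iff[of I x y] coset_eq_iff[of I "g y" "g x"] by blast
  moreover have "x \<in> I +>\<^bsub>A\<^esub> x"
    using assms(1,2) by (simp add: mem_coset_iff a_minus_def M.r_neg submodule_zero)
  ultimately show ?thesis by blast
qed

lemma
  assumes I: "two_sided_ideal K A I"
  shows quotient_hom: "(+>\<^bsub>A\<^esub>) I \<in> superalgebra_hom K A (superalgebra_quotient A I)" (is "?\<pi> \<in> _")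
    and quotient_surj: "(+>\<^bsub>A\<^esub>) I ` carrier A = carrier (superalgebra_quotient A I)"
    and quotient_module: "module K (superalgebra_quotient A I)"
proof -
  let ?Q = "superalgebra_quotient A I"
  have sub: "submodule I K A" using I by (simp add: two_sided_ideal_def)
  have I_l: "\<langle>x, y\<rangle>\<^bsub>A\<^esub> \<in> I" and I_r: "\<langle>y, x\<rangle>\<^bsub>A\<^esub> \<in> I" if "x \<in> carrier A" "y \<in> I" for x y
    using I that by (auto simp: two_sided_ideal_def)
  interpret I: abelian_subgroup I A
    by (rule abelian_subgroupI3[OF additive_subgroup.intro[OF submodule.axioms(1)[OF sub]]]) unfold_locales
  show surj: "?\<pi> ` carrier A = carrier ?Q"
    by (auto simp: superalgebra_quotient_def A_RCOSETS_def')
  have add: "?\<pi> (x \<oplus>\<^bsub>A\<^esub> y) = ?\<pi> x \<oplus>\<^bsub>?Q\<^esub> ?\<pi> y" if "x \<in> carrier A" "y \<in> carrier A" for x y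
    using that by (simp add: superalgebra_quotient_def I.a_rcos_sum)
  have smult: "?\<pi> (c \<odot>\<^bsub>A\<^esub> x) = c \<odot>\<^bsub>?Q\<^esub> ?\<pi> x" if c: "c \<in> carrier K" and x: "x \<in> carrier A" for c x
  proof -
    have "c \<odot>\<^bsub>A\<^esub> y \<ominus>\<^bsub>A\<^esub> c \<odot>\<^bsub>A\<^esub> x \<in> I" if "y \<in> carrier A" "y \<ominus>\<^bsub>A\<^esub> x \<in> I" for y
    proof -
      have "c \<odot>\<^bsub>A\<^esub> y \<ominus>\<^bsub>A\<^esub> c \<odot>\<^bsub>A\<^esub> x = c \<odot>\<^bsub>A\<^esub> (y \<ominus>\<^bsub>A\<^esub> x)"
        using c x that by (simp add: a_minus_def smult_r_distr smult_r_minus)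
      then show ?thesis using submoduleE(4)[OF sub c that(2)] by simp
    qed
    then show ?thesis
      using coset_image_Union[OF sub x, of "\<lambda>y. c \<odot>\<^bsub>A\<^esub> y"] c x by (simp add: superalgebra_quotient_def)
  qed
  have bracket: "?\<pi> \<langle>x, y\<rangle>\<^bsub>A\<^esub> = \<langle>?\<pi> x, ?\<pi> y\<rangle>\<^bsub>?Q\<^esub>" if x: "x \<in> carrier A" and y: "y \<in> carrier A" for x y
  proof -
    \<comment> \<open>The double union collapses one argument at a time: the inner one because
      \<open>I\<close> absorbs brackets from the left, the outer one because it absorbs them from
      the right.\<close>
    have "(\<Union>x'\<in>?\<pi> x. \<Union>y'\<in>?\<pi> y. ?\<pi> \<langle>x', y'\<rangle>\<^bsub>A\<^esub>) = (\<Union>x'\<in>?\<pi> x. ?\<pi> \<langle>x', y\<rangle>\<^bsub>A\<^esub>)"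
    proof (rule SUP_cong[OF refl])
      fix x' assume "x' \<in> ?\<pi> x"
      then have x': "x' \<in> carrier A"
        using a_r_coset_subset_G[OF submoduleE(1)[OF sub] x] by blast
      show "(\<Union>y'\<in>?\<pi> y. ?\<pi> \<langle>x', y'\<rangle>\<^bsub>A\<^esub>) = ?\<pi> \<langle>x', y\<rangle>\<^bsub>A\<^esub>"
        by (rule coset_image_Union[OF sub y, of "\<lambda>y. \<langle>x', y\<rangle>\<^bsub>A\<^esub>"])
          (use x' y in \<open>simp_all add: I_l bracket_closed flip: bracket_diff_right\<close>)
    qed
    also have "\<dots> = ?\<pi> \<langle>x, y\<rangle>\<^bsub>A\<^esub>"
      by (rule coset_image_Union[OF sub x, of "\<lambda>x. \<langle>x, y\<rangle>\<^bsub>A\<^esub>"])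
        (use x y in \<open>simp_all add: I_r bracket_closed flip: bracket_diff_left\<close>)
    finally show ?thesis by (simp add: superalgebra_quotient_def)
  qed
  have closed: "?\<pi> x \<in> carrier ?Q" if "x \<in> carrier A" for x using that surj by blast
  show "?\<pi> \<in> superalgebra_hom K A ?Q"
    by (rule superalgebra_homI) (simp_all add: closed add smult bracket, auto simp: superalgebra_quotient_def)
  have zero: "\<zero>\<^bsub>?Q\<^esub> = ?\<pi> \<zero>\<^bsub>A\<^esub>"
    
    using M.a_coset_join2[OF M.zero_closed submodule.axioms(1)[OF sub] submodule_zero[OF sub]]
    by (simp add: superalgebra_quotient_def)
  show "module K ?Q" by (rule module_surjective_image[OF surj add smult zero])
qed

lemma quotient_part: "part (superalgebra_quotient A I) a = (+>\<^bsub>A\<^esub>) I ` part A a"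
  by (simp add: superalgebra_quotient_def)

lemma quotient_zero: "\<zero>\<^bsub>superalgebra_quotient A I\<^esub> = I"
  by (simp add: superalgebra_quotient_def)

end

section \<open>The centre of a Lie superalgebra\<close>

context lie_superalgebra
begin

text \<open>Against a homogeneous \<open>x\<close>, the bracket with a component of \<open>z\<close>
  is a component of the bracket with \<open>z\<close>, which is zero. General \<open>x\<close>
  follow by additivity.\<close>

lemma center_component:
  assumes "z \<in> lie_center L" shows "component L a z \<in> lie_center L"
proof -
  have z: "z \<in> carrier L" "\<And>x. x \<in> carrier L \<Longrightarrow> \<langle>z, x\<rangle>\<^bsub>L\<^esub> = \<zero>\<^bsub>L\<^esub>"
    using assms by (auto simp: lie_center_def)
  have h: "\<langle>component L a z, x\<rangle>\<^bsub>L\<^esub> = \<zero>\<^bsub>L\<^esub>" if "x \<in> part L b" for x b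
    using component_bracket_part[OF z(1) that, of a] z(2)[OF part_closed[OF that]]
    by (simp add: component_zero)
  have "\<langle>component L a z, x\<rangle>\<^bsub>L\<^esub> = \<zero>\<^bsub>L\<^esub>" if x: "x \<in> carrier L" for x
    using decompose[OF x, of 0] h bracket_add_right component_closed[OF z(1)] part_closed
      M.l_zero M.zero_closed by metis
  then show ?thesis using z(1) by (simp add: lie_center_def component_closed)
qed

text \<open>The centre is defined by brackets from one side, and skew-symmetry is available for
  homogeneous elements only. Both arguments are therefore split into components, the components of
  \<open>z\<close> being central again.\<close>

lemma center_bracket_right:
  assumes "z \<in> lie_center L" "x \<in> carrier L" shows "\<langle>x, z\<rangle>\<^bsub>L\<^esub> = \<zero>\<^bsub>L\<^esub>"
proof -
  have zc: "z \<in> carrier L" using assms(1) by (simp add: lie_center_def)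
  have h: "\<langle>u, component L b z\<rangle>\<^bsub>L\<^esub> = \<zero>\<^bsub>L\<^esub>" if u: "u \<in> part L a" for u a b
  proof -
    have 0: "\<langle>component L b z, u\<rangle>\<^bsub>L\<^esub> = \<zero>\<^bsub>L\<^esub>"
      using center_component[OF assms(1)] part_closed[OF u] by (simp add: lie_center_def)
    have "koszul L a b \<langle>component L b z, u\<rangle>\<^bsub>L\<^esub> = \<zero>\<^bsub>L\<^esub>" unfolding koszul_def 0 by simp
    then show ?thesis using super_skew[OF u component_part[OF zc]] by simp
  qed
  have "\<langle>u, z\<rangle>\<^bsub>L\<^esub> = \<zero>\<^bsub>L\<^esub>" if u: "u \<in> part L a" for u a
    using component_sum[OF zc, of 0] h[OF u] bracket_add_right[OF part_closed[OF u]
      component_closed[OF zc, of 0] component_closed[OF zc, of "0+1"]] by simp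
  then show ?thesis
    using decompose[OF assms(2), of 0] bracket_add_left zc part_closed M.l_zero M.zero_closed by metis
qed

lemma center_ideal: "two_sided_ideal K L (lie_center L)"
proof -
  have "\<langle>\<ominus>\<^bsub>L\<^esub> z, x\<rangle>\<^bsub>L\<^esub> = \<zero>\<^bsub>L\<^esub>" if "z \<in> lie_center L" "x \<in> carrier L" for z x
    using that bracket_smult_left[of "\<ominus>\<^bsub>K\<^esub> \<one>\<^bsub>K\<^esub>" z x] by (simp add: lie_center_def smult_l_minus)
  then have sub: "submodule (lie_center L) K L"
    by (intro submoduleI)
      (auto simp: lie_center_def bracket_zero_left bracket_add_left bracket_smult_left)
  then show ?thesis
    by (auto simp: two_sided_ideal_def center_bracket_right submodule_zero)
      (simp add: lie_center_def bracket_zero_left)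
qed

end

section \<open>Surjective endomorphisms in finite dimension\<close>

text \<open>The elements of the displayed form constitute a submodule that contains \<open>S\<close>
  and \<open>b\<close>, and the span is the least such submodule.\<close>

lemma (in module) lspan_insert:
  assumes S: "S \<subseteq> carrier M" and b: "b \<in> carrier M" and x: "x \<in> lspan R M (insert b S)"
  obtains c s where "c \<in> carrier R" "s \<in> lspan R M S" "x = s \<oplus>\<^bsub>M\<^esub> c \<odot>\<^bsub>M\<^esub> b"
proof -
  let ?U = "lspan R M S"
  let ?W = "{x. \<exists>c\<in>carrier R. \<exists>s\<in>?U. x = s \<oplus>\<^bsub>M\<^esub> c \<odot>\<^bsub>M\<^esub> b}"
  have U: "submodule ?U R M" by (rule lspan_submodule[OF S])
  have zero: "\<zero>\<^bsub>M\<^esub> \<in> ?U" using subgroup.one_closed[OF submodule.axioms(1)[OF U]] by simp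
  have UM: "s \<in> carrier M" if "s \<in> ?U" for s using submoduleE(1)[OF U] that by blast
  have "submodule ?W R M"
  proof (rule submoduleI)
    show "?W \<subseteq> carrier M" using UM b by auto
    show "\<zero>\<^bsub>M\<^esub> \<in> ?W" using zero b by (auto intro!: bexI[of _ "\<zero>\<^bsub>R\<^esub>"] bexI[of _ "\<zero>\<^bsub>M\<^esub>"])
  next
    fix x assume "x \<in> ?W"
    then obtain c s where cs: "c \<in> carrier R" "s \<in> ?U" "x = s \<oplus>\<^bsub>M\<^esub> c \<odot>\<^bsub>M\<^esub> b" by blast
    have "\<ominus>\<^bsub>M\<^esub> x = \<ominus>\<^bsub>M\<^esub> s \<oplus>\<^bsub>M\<^esub> (\<ominus>\<^bsub>R\<^esub> c) \<odot>\<^bsub>M\<^esub> b"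
      using cs b UM by (simp add: smult_l_minus M.minus_add)
    then show "\<ominus>\<^bsub>M\<^esub> x \<in> ?W" using cs submoduleE(3)[OF U] by blast
    fix y assume "y \<in> ?W"
    then obtain d t where dt: "d \<in> carrier R" "t \<in> ?U" "y = t \<oplus>\<^bsub>M\<^esub> d \<odot>\<^bsub>M\<^esub> b" by blast
    have "x \<oplus>\<^bsub>M\<^esub> y = (s \<oplus>\<^bsub>M\<^esub> t) \<oplus>\<^bsub>M\<^esub> (c \<oplus>\<^bsub>R\<^esub> d) \<odot>\<^bsub>M\<^esub> b"
      using cs dt b UM by (simp add: smult_l_distr M.a_ac)
    then show "x \<oplus>\<^bsub>M\<^esub> y \<in> ?W" using cs dt submoduleE(5)[OF U] by blast
  next
    fix d x assume d: "d \<in> carrier R" and "x \<in> ?W"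
    then obtain c s where cs: "c \<in> carrier R" "s \<in> ?U" "x = s \<oplus>\<^bsub>M\<^esub> c \<odot>\<^bsub>M\<^esub> b" by blast
    have "d \<odot>\<^bsub>M\<^esub> x = d \<odot>\<^bsub>M\<^esub> s \<oplus>\<^bsub>M\<^esub> (d \<otimes>\<^bsub>R\<^esub> c) \<odot>\<^bsub>M\<^esub> b"
      using cs d b UM by (simp add: smult_r_distr smult_assoc1)
    then show "d \<odot>\<^bsub>M\<^esub> x \<in> ?W" using cs d submoduleE(4)[OF U] by blast
  qed
  moreover have "insert b S \<subseteq> ?W"
  proof -
    have "b = \<zero>\<^bsub>M\<^esub> \<oplus>\<^bsub>M\<^esub> \<one>\<^bsub>R\<^esub> \<odot>\<^bsub>M\<^esub> b" using b by simp
    moreover have "s = s \<oplus>\<^bsub>M\<^esub> \<zero>\<^bsub>R\<^esub> \<odot>\<^bsub>M\<^esub> b" if "s \<in> S" for s using that b S by auto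
    moreover have "S \<subseteq> ?U" unfolding lspan_def by (rule hull_subset)
    ultimately show ?thesis using zero R.zero_closed R.one_closed by blast
  qed
  ultimately have "lspan R M (insert b S) \<subseteq> ?W" unfolding lspan_def by (intro hull_minimal)
  then show thesis using x that by blast
qed

text \<open>Induction on the spanning set replaces a dimension argument. When \<open>b\<close> is
  added, either the chain never leaves the old span from index \<open>k\<close> on, or some
  \<open>U i\<close> contains a vector \<open>w\<close> with nonzero coefficient at
  \<open>b\<close>. In the second case \<open>w\<close> accounts for the new direction, and the
  chain is constant from \<open>i\<close> on.\<close>

lemma ascending_chain_lspan:
  fixes K :: "('a, 'k) ring_scheme" and V :: "('a, 'v, 'm) module_scheme"
  assumes "field K" "module K V" and "finite B" "B \<subseteq> carrier V"
    and U: "\<And>k. submodule (U k) K V" and mono: "\<And>j k :: nat. j \<le> k \<Longrightarrow> U j \<subseteq> U k"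
  shows "\<exists>k. \<forall>j\<ge>k. U j \<inter> lspan K V B = U k \<inter> lspan K V B"
  using assms(3,4)
proof (induction B rule: finite_induct)
  interpret module K V by fact
  case empty
  have "submodule {\<zero>\<^bsub>V\<^esub>} K V" by (rule submoduleI) auto
  then have "lspan K V {} \<subseteq> {\<zero>\<^bsub>V\<^esub>}" unfolding lspan_def by (intro hull_minimal) auto
  moreover have "\<zero>\<^bsub>V\<^esub> \<in> U k" for k
    using subgroup.one_closed[OF submodule.axioms(1)[OF U]] by simp
  ultimately show ?case by blast
next
  interpret field K by fact
  interpret module K V by fact
  case (insert b B)
  let ?S = "lspan K V B" and ?S' = "lspan K V (insert b B)"
  have b: "b \<in> carrier V" and B: "B \<subseteq> carrier V" using insert.prems by auto
  have S: "submodule ?S K V" using lspan_submodule[OF B] .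
  have S': "submodule ?S' K V" using lspan_submodule insert.prems by blast
  have SV: "s \<in> carrier V" if "s \<in> ?S" for s using that submoduleE(1)[OF S] by blast
  have SS': "?S \<subseteq> ?S'" unfolding lspan_def by (intro hull_mono) auto
  obtain k where k: "\<And>j. j \<ge> k \<Longrightarrow> U j \<inter> ?S = U k \<inter> ?S" using insert B by blast
  show ?case
  proof (cases "\<exists>i\<ge>k. \<exists>w\<in>U i \<inter> ?S'. w \<notin> ?S")
    case False
    then show ?thesis using k SS' by (intro exI[of _ k]) blast
  next
    case True
    then obtain i w where i: "i \<ge> k" and w: "w \<in> U i" "w \<in> ?S'" "w \<notin> ?S" by blast
    obtain c s where cs: "c \<in> carrier K" "s \<in> ?S" "w = s \<oplus>\<^bsub>V\<^esub> c \<odot>\<^bsub>V\<^esub> b"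
      using lspan_insert[OF B b w(2)] by blast
    have "c \<noteq> \<zero>\<^bsub>K\<^esub>" using cs w(3) b SV[OF cs(2)] by auto
    then have c: "inv\<^bsub>K\<^esub> c \<in> carrier K" "inv\<^bsub>K\<^esub> c \<otimes>\<^bsub>K\<^esub> c = \<one>\<^bsub>K\<^esub>"
      using cs(1) by (simp_all add: field_Units)
    have "u \<in> U i" if j: "j \<ge> i" and u: "u \<in> U j" "u \<in> ?S'" for j u
    proof -
      obtain d t where dt: "d \<in> carrier K" "t \<in> ?S" "u = t \<oplus>\<^bsub>V\<^esub> d \<odot>\<^bsub>V\<^esub> b"
        using lspan_insert[OF B b u(2)] by blast
      \<comment> \<open>The multiple of \<open>w\<close> with the same coefficient at
        \<open>b\<close> as \<open>u\<close>. Subtracting it leaves an element of \<open>U j\<close>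
        in the old span, where the chain is already stationary, hence an element of
        \<open>U i\<close>.\<close>
      let ?e = "d \<otimes>\<^bsub>K\<^esub> inv\<^bsub>K\<^esub> c"
      have e: "?e \<in> carrier K" using dt(1) c(1) by simp
      have ec: "?e \<otimes>\<^bsub>K\<^esub> c = d" using dt(1) c cs(1) by (simp add: m_assoc)
      have ew: "?e \<odot>\<^bsub>V\<^esub> w = ?e \<odot>\<^bsub>V\<^esub> s \<oplus>\<^bsub>V\<^esub> d \<odot>\<^bsub>V\<^esub> b"
        using cs e b SV[OF cs(2)] by (simp add: smult_r_distr ec flip: smult_assoc1)
      let ?r = "t \<oplus>\<^bsub>V\<^esub> \<ominus>\<^bsub>V\<^esub> (?e \<odot>\<^bsub>V\<^esub> s)"
      have es: "?e \<odot>\<^bsub>V\<^esub> s \<in> ?S" using submoduleE(4)[OF S e cs(2)] .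
      have u_eq: "u = ?r \<oplus>\<^bsub>V\<^esub> ?e \<odot>\<^bsub>V\<^esub> w"
        using dt(1,3) b SV[OF dt(2)] SV[OF es] unfolding ew
        by (simp add: M.a_assoc M.r_neg1)
      have rS: "?r \<in> ?S" using submoduleE(5)[OF S dt(2) submoduleE(3)[OF S es]] .
      have ewU: "?e \<odot>\<^bsub>V\<^esub> w \<in> U i" using submoduleE(4)[OF U e w(1)] .
      have "?r = u \<oplus>\<^bsub>V\<^esub> \<ominus>\<^bsub>V\<^esub> (?e \<odot>\<^bsub>V\<^esub> w)"
        using SV[OF rS] submoduleE(1)[OF U[of i]] ewU
        by (subst u_eq) (auto simp: M.a_assoc M.r_neg)
      moreover have "?e \<odot>\<^bsub>V\<^esub> w \<in> U j" using ewU mono[OF j] by blast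
      ultimately have "?r \<in> U j" using submoduleE(3,5)[OF U[of j]] u(1) by metis
      then have "?r \<in> U i" using rS k[of j] k[of i] i j by auto
      then show ?thesis using submoduleE(5)[OF U[of i] _ ewU] u_eq by metis
    qed
    then show ?thesis using mono by (intro exI[of _ i]) blast
  qed
qed

text \<open>The kernels of the powers of \<open>T\<close> form an ascending chain, which becomes stationary.\<close>

lemma surjective_endomorphism_injective:
  fixes K :: "('a, 'k) ring_scheme" and V :: "('a, 'v, 'm) module_scheme"
  assumes "field K" "module K V" and B: "finite B" "B \<subseteq> carrier V" "carrier V \<subseteq> lspan K V B"
    and surj: "T ` carrier V = carrier V"
    and add: "\<And>x y. \<lbrakk>x \<in> carrier V; y \<in> carrier V\<rbrakk> \<Longrightarrow> T (x \<oplus>\<^bsub>V\<^esub> y) = T x \<oplus>\<^bsub>V\<^esub> T y"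
    and smult: "\<And>c x. \<lbrakk>c \<in> carrier K; x \<in> carrier V\<rbrakk> \<Longrightarrow> T (c \<odot>\<^bsub>V\<^esub> x) = c \<odot>\<^bsub>V\<^esub> T x"
    and x: "x \<in> carrier V" "T x = \<zero>\<^bsub>V\<^esub>"
  shows "x = \<zero>\<^bsub>V\<^esub>"
proof -
  interpret module K V by fact
  have closed: "(T ^^ k) y \<in> carrier V" if "y \<in> carrier V" for k y
    using that surj by (induction k) auto
  have surj_k: "\<exists>y\<in>carrier V. (T ^^ k) y = z" if "z \<in> carrier V" for k z
    using that
  proof (induction k arbitrary: z)
    case (Suc k)
    obtain z' where z': "z' \<in> carrier V" "z = T z'" using Suc.prems surj by blast
    with Suc.IH show ?case by force
  qed auto
  have zero: "T \<zero>\<^bsub>V\<^esub> = \<zero>\<^bsub>V\<^esub>" using smult[of "\<zero>\<^bsub>K\<^esub>" "\<zero>\<^bsub>V\<^esub>"] closed[of "\<zero>\<^bsub>V\<^esub>" 1] by simp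
  have zero_k: "(T ^^ k) \<zero>\<^bsub>V\<^esub> = \<zero>\<^bsub>V\<^esub>" for k by (induction k) (simp_all add: zero)
  have add_k: "(T ^^ k) (y \<oplus>\<^bsub>V\<^esub> z) = (T ^^ k) y \<oplus>\<^bsub>V\<^esub> (T ^^ k) z"
    if "y \<in> carrier V" "z \<in> carrier V" for k y z
    using that by (induction k) (simp_all add: add closed)
  have smult_k: "(T ^^ k) (c \<odot>\<^bsub>V\<^esub> y) = c \<odot>\<^bsub>V\<^esub> (T ^^ k) y"
    if "c \<in> carrier K" "y \<in> carrier V" for k c y
    using that by (induction k) (simp_all add: smult closed)
  define U where "U k = {y \<in> carrier V. (T ^^ k) y = \<zero>\<^bsub>V\<^esub>}" for k
  have U: "submodule (U k) K V" for k
  proof (rule submoduleI)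
    show "\<ominus>\<^bsub>V\<^esub> y \<in> U k" if "y \<in> U k" for y
      using that smult_k[of "\<ominus>\<^bsub>K\<^esub> \<one>\<^bsub>K\<^esub>" y k] by (simp add: U_def smult_l_minus)
  qed (auto simp: U_def zero_k add_k smult_k)
  have "U k \<subseteq> U (Suc k)" for k by (auto simp: U_def zero)
  then have mono: "U j \<subseteq> U k" if "j \<le> k" for j k using lift_Suc_mono_le[of U] that by blast
  obtain k where k: "\<And>j. j \<ge> k \<Longrightarrow> U j \<inter> lspan K V B = U k \<inter> lspan K V B"
    using ascending_chain_lspan[of K V B U, OF assms(1,2) B(1,2) U mono] by metis
  \<comment> \<open>Surjectivity writes \<open>x\<close> as the \<open>k\<close>-th iterate at
    \<open>y\<close>. Then \<open>y\<close> is killed by the next iterate, hence by the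
    \<open>k\<close>-th one because the kernels are stationary, and its image \<open>x\<close>
    vanishes.\<close>
  obtain y where y: "y \<in> carrier V" "(T ^^ k) y = x" using surj_k[OF x(1), of k] by blast
  then have "y \<in> U (Suc k)" using x(2) by (simp add: U_def)
  then have "y \<in> U k" using k[of "Suc k"] y(1) B(3) by auto
  then show ?thesis using y(2) by (simp add: U_def)
qed

section \<open>The universal property of free Lie superalgebras\<close>

definition unit_family :: "('a, 'k) ring_scheme \<Rightarrow> 'x bracketing \<Rightarrow> 'x bracketing \<Rightarrow> 'a" where
  "unit_family K t = (\<lambda>s. if s = t then \<one>\<^bsub>K\<^esub> else \<zero>\<^bsub>K\<^esub>)"

lemma free_superalgebra_carrier_iff:
  "f \<in> carrier (free_superalgebra K X d) \<longleftrightarrow>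
    (\<forall>t. f t \<in> carrier K) \<and> finite {t. f t \<noteq> \<zero>\<^bsub>K\<^esub>} \<and> (\<forall>t. f t \<noteq> \<zero>\<^bsub>K\<^esub> \<longrightarrow> letters t \<subseteq> X)"
  by (auto simp: free_superalgebra_def Let_def image_subset_iff)

lemma free_superalgebra_part_iff:
  "f \<in> part (free_superalgebra K X d) a \<longleftrightarrow>
    f \<in> carrier (free_superalgebra K X d) \<and> (\<forall>t. f t \<noteq> \<zero>\<^bsub>K\<^esub> \<longrightarrow> degree d t = a)"
  by (simp add: free_superalgebra_def Let_def)

lemma free_superalgebra_simps:
  "\<zero>\<^bsub>free_superalgebra K X d\<^esub> = (\<lambda>t. \<zero>\<^bsub>K\<^esub>)"
  "f \<oplus>\<^bsub>free_superalgebra K X d\<^esub> g = (\<lambda>t. f t \<oplus>\<^bsub>K\<^esub> g t)"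
  "c \<odot>\<^bsub>free_superalgebra K X d\<^esub> f = (\<lambda>t. c \<otimes>\<^bsub>K\<^esub> f t)"
  "\<langle>f, g\<rangle>\<^bsub>free_superalgebra K X d\<^esub>
    = (\<lambda>t. case t of Letter x \<Rightarrow> \<zero>\<^bsub>K\<^esub> | Bracketing r s \<Rightarrow> f r \<otimes>\<^bsub>K\<^esub> g s)"
  by (simp_all add: free_superalgebra_def Let_def)

context field
begin

lemma free_superalgebra_add_closed:
  assumes "f \<in> carrier (free_superalgebra R X d)" "g \<in> carrier (free_superalgebra R X d)"
  shows "f \<oplus>\<^bsub>free_superalgebra R X d\<^esub> g \<in> carrier (free_superalgebra R X d)"
proof -
  have "{t. f t \<oplus> g t \<noteq> \<zero>} \<subseteq> {t. f t \<noteq> \<zero>} \<union> {t. g t \<noteq> \<zero>}" by auto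
  moreover have "letters t \<subseteq> X" if "f t \<oplus> g t \<noteq> \<zero>" for t
    using that assms by (cases "f t = \<zero>") (auto simp: free_superalgebra_carrier_iff)
  ultimately show ?thesis
    using assms by (auto simp: free_superalgebra_carrier_iff free_superalgebra_simps
        elim!: finite_subset)
qed

lemma free_superalgebra_smult_closed:
  assumes "c \<in> carrier R" "f \<in> carrier (free_superalgebra R X d)"
  shows "c \<odot>\<^bsub>free_superalgebra R X d\<^esub> f \<in> carrier (free_superalgebra R X d)"
proof -
  have "{t. c \<otimes> f t \<noteq> \<zero>} \<subseteq> {t. f t \<noteq> \<zero>}" using assms(1) by auto
  moreover have "letters t \<subseteq> X" if "c \<otimes> f t \<noteq> \<zero>" for t
    using that assms by (cases "f t = \<zero>") (auto simp: free_superalgebra_carrier_iff)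
  ultimately show ?thesis
    using assms by (auto simp: free_superalgebra_carrier_iff free_superalgebra_simps
        elim!: finite_subset)
qed

lemma free_superalgebra_bracket_closed:
  assumes f: "f \<in> carrier (free_superalgebra R X d)" and g: "g \<in> carrier (free_superalgebra R X d)"
  shows "\<langle>f, g\<rangle>\<^bsub>free_superalgebra R X d\<^esub> \<in> carrier (free_superalgebra R X d)" (is "?b \<in> _")
proof -
  have supp: "\<exists>r s. t = Bracketing r s \<and> f r \<noteq> \<zero> \<and> g s \<noteq> \<zero>" if "?b t \<noteq> \<zero>" for t
    using that assms
    by (cases t) (auto simp: free_superalgebra_carrier_iff free_superalgebra_simps)
  \<comment> \<open>The support of a product consists of bracketings of a pair from the two
    supports, so it is finite.\<close>
  then have "{t. ?b t \<noteq> \<zero>} \<subseteq> (\<lambda>(r, s). Bracketing r s) ` ({t. f t \<noteq> \<zero>} \<times> {t. g t \<noteq> \<zero>})" by force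
  moreover have "finite ({t. f t \<noteq> \<zero>} \<times> {t. g t \<noteq> \<zero>})"
    using assms by (simp add: free_superalgebra_carrier_iff)
  ultimately have "finite {t. ?b t \<noteq> \<zero>}" by (meson finite_imageI finite_subset)
  moreover have "letters t \<subseteq> X" if t: "?b t \<noteq> \<zero>" for t
  proof -
    obtain r s where "t = Bracketing r s" "f r \<noteq> \<zero>" "g s \<noteq> \<zero>" using supp[OF t] by blast
    moreover from this have "letters r \<subseteq> X" "letters s \<subseteq> X"
      using assms by (simp_all add: free_superalgebra_carrier_iff)
    ultimately show ?thesis by simp
  qed
  moreover have "?b t \<in> carrier R" for t
    using assms by (cases t) (auto simp: free_superalgebra_carrier_iff free_superalgebra_simps)
  ultimately show ?thesis by (simp add: free_superalgebra_carrier_iff)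
qed

lemma free_superalgebra_uminus_closed:
  assumes "f \<in> carrier (free_superalgebra R X d)"
  shows "(\<lambda>t. \<ominus> f t) \<in> carrier (free_superalgebra R X d)"
proof -
  have "(\<lambda>t. \<ominus> f t) = (\<ominus> \<one>) \<odot>\<^bsub>free_superalgebra R X d\<^esub> f"
    using assms by (auto simp: free_superalgebra_carrier_iff free_superalgebra_simps l_minus)
  then show ?thesis using free_superalgebra_smult_closed[OF _ assms, of "\<ominus> \<one>"] by simp
qed

lemma free_superalgebra_module: "module R (free_superalgebra R X d)"
proof (rule moduleI)
  let ?V = "free_superalgebra R X d"
  show "abelian_group ?V"
  proof (rule abelian_groupI)
    fix f assume f: "f \<in> carrier ?V"
    show "\<exists>g\<in>carrier ?V. g \<oplus>\<^bsub>?V\<^esub> f = \<zero>\<^bsub>?V\<^esub>"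
      using f by (intro bexI[OF _ free_superalgebra_uminus_closed[OF f]])
        (auto simp: free_superalgebra_simps free_superalgebra_carrier_iff l_neg)
  qed (auto simp: free_superalgebra_add_closed,
      auto simp: free_superalgebra_simps free_superalgebra_carrier_iff a_ac)
qed (unfold_locales, auto simp: free_superalgebra_smult_closed,
    auto simp: free_superalgebra_simps free_superalgebra_carrier_iff l_distr r_distr m_assoc)

lemma free_superalgebra_superalgebra: "superalgebra R (free_superalgebra R X d)"
proof (intro superalgebra.intro superalgebra_axioms.intro)
  let ?V = "free_superalgebra R X d"
  show "field R" by (rule field_axioms)
  show "module R ?V" by (rule free_superalgebra_module)
  then interpret V: module R ?V .
  have eval: "f t \<in> carrier R" if "f \<in> carrier ?V" for f t
    using that by (simp add: free_superalgebra_carrier_iff)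
  show "submodule (part ?V a) R ?V" for a
  proof (rule V.submoduleI)
    show "f \<oplus>\<^bsub>?V\<^esub> g \<in> part ?V a" if "f \<in> part ?V a" "g \<in> part ?V a" for f g
    proof -
      have "f t \<noteq> \<zero> \<or> g t \<noteq> \<zero>" if "f t \<oplus> g t \<noteq> \<zero>" for t using that by auto
      then show ?thesis using that free_superalgebra_add_closed[of f X d g]
        by (simp add: free_superalgebra_part_iff) (auto simp: free_superalgebra_simps)
    qed
    have smult: "c \<odot>\<^bsub>?V\<^esub> f \<in> part ?V a" if "c \<in> carrier R" "f \<in> part ?V a" for c f
    proof -
      have "f t \<noteq> \<zero>" if "c \<otimes> f t \<noteq> \<zero>" for t using that \<open>c \<in> carrier R\<close> by auto
      then show ?thesis using that free_superalgebra_smult_closed[of c f X d]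
        by (simp add: free_superalgebra_part_iff) (auto simp: free_superalgebra_simps)
    qed
    then show "c \<odot>\<^bsub>?V\<^esub> f \<in> part ?V a" if "c \<in> carrier R" "f \<in> part ?V a" for c f using that .
    show "\<ominus>\<^bsub>?V\<^esub> f \<in> part ?V a" if "f \<in> part ?V a" for f
      using smult[of "\<ominus> \<one>" f] that V.smult_l_minus[of \<one> f] by (simp add: free_superalgebra_part_iff)
  qed (auto simp: free_superalgebra_part_iff, auto simp: free_superalgebra_simps)
  show "carrier ?V = part ?V 0 <+>\<^bsub>?V\<^esub> part ?V 1"
  proof
    show "part ?V 0 <+>\<^bsub>?V\<^esub> part ?V 1 \<subseteq> carrier ?V"
      by (auto simp: set_add_defs free_superalgebra_part_iff)
    show "carrier ?V \<subseteq> part ?V 0 <+>\<^bsub>?V\<^esub> part ?V 1"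
    proof
      fix f assume f: "f \<in> carrier ?V"
      define r where "r a = (\<lambda>t. if degree d t = a then f t else \<zero>)" for a
      have "finite {t. r a t \<noteq> \<zero>}" for a
        using f by (rule_tac finite_subset[of _ "{t. f t \<noteq> \<zero>}"])
          (auto simp: r_def free_superalgebra_carrier_iff)
      then have "r a \<in> part ?V a" for a
        using f by (auto simp: free_superalgebra_part_iff free_superalgebra_carrier_iff)
          (auto simp: r_def split: if_splits)
      moreover have "f = r 0 \<oplus>\<^bsub>?V\<^esub> r 1"
        by (rule ext) (use eval[OF f] in \<open>auto simp: free_superalgebra_simps r_def\<close>)
      ultimately show "f \<in> part ?V 0 <+>\<^bsub>?V\<^esub> part ?V 1" by (auto simp: set_add_defs)
    qed
  qed
  show "part ?V 0 \<inter> part ?V 1 = {\<zero>\<^bsub>?V\<^esub>}"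
    by (auto simp: free_superalgebra_part_iff free_superalgebra_carrier_iff free_superalgebra_simps)
  show "\<langle>f, g\<rangle>\<^bsub>?V\<^esub> \<in> part ?V (a + b)" if "f \<in> part ?V a" "g \<in> part ?V b" for f g a b
  proof -
    have "\<langle>f, g\<rangle>\<^bsub>?V\<^esub> \<in> carrier ?V" "f \<in> carrier ?V" "g \<in> carrier ?V"
      using that by (simp_all add: free_superalgebra_part_iff free_superalgebra_bracket_closed)
    moreover have "degree d t = a + b" if "\<langle>f, g\<rangle>\<^bsub>?V\<^esub> t \<noteq> \<zero>" for t
    proof (cases t)
      case (Bracketing r s)
      have "f r \<noteq> \<zero>" "g s \<noteq> \<zero>"
        using that Bracketing calculation eval by (auto simp: free_superalgebra_simps)
      then show ?thesis
        using \<open>f \<in> part ?V a\<close> \<open>g \<in> part ?V b\<close> Bracketing by (simp add: free_superalgebra_part_iff)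
    qed (use that in \<open>simp add: free_superalgebra_simps\<close>)
    ultimately show ?thesis by (simp add: free_superalgebra_part_iff)
  qed
qed (auto simp: free_superalgebra_bracket_closed,
    auto simp: free_superalgebra_simps free_superalgebra_carrier_iff l_distr r_distr m_ac
      split: bracketing.splits)

lemma unit_family_carrier:
  "letters t \<subseteq> X \<Longrightarrow> unit_family R t \<in> carrier (free_superalgebra R X d)"
  by (auto simp: free_superalgebra_carrier_iff unit_family_def)

lemma unit_family_part:
  "letters t \<subseteq> X \<Longrightarrow> unit_family R t \<in> part (free_superalgebra R X d) (degree d t)"
  by (auto simp: free_superalgebra_part_iff unit_family_carrier) (auto simp: unit_family_def split: if_splits)

lemma unit_family_bracket:
  "\<langle>unit_family R r, unit_family R s\<rangle>\<^bsub>free_superalgebra R X d\<^esub> = unit_family R (Bracketing r s)"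
  by (rule ext) (auto simp: free_superalgebra_simps unit_family_def split: bracketing.split)

text \<open>Adds up the terms of \<open>f\<close> over growing finite subsets of its support. The
  unit case retains \<open>f t \<noteq> \<zero>\<close> for the original \<open>f\<close>, so that
  for homogeneous \<open>f\<close> only bracketings of the right degree occur.\<close>

lemma free_superalgebra_induct [consumes 1, case_names zero add unit]:
  fixes X :: "'x set" and d :: "'x \<Rightarrow> bit"
  defines "V \<equiv> free_superalgebra R X d"
  assumes f: "f \<in> carrier V"
    and zero: "P \<zero>\<^bsub>V\<^esub>"
    and add: "\<And>g h. \<lbrakk>g \<in> carrier V; h \<in> carrier V; P g; P h\<rbrakk> \<Longrightarrow> P (g \<oplus>\<^bsub>V\<^esub> h)"
    and unit: "\<And>c t. \<lbrakk>c \<in> carrier R; f t \<noteq> \<zero>; letters t \<subseteq> X\<rbrakk> \<Longrightarrow> P (c \<odot>\<^bsub>V\<^esub> unit_family R t)"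
  shows "P f"
proof -
  let ?r = "\<lambda>S t. if t \<in> S then f t else \<zero>"
  have fc: "f t \<in> carrier R" "f t \<noteq> \<zero> \<Longrightarrow> letters t \<subseteq> X" and fin: "finite {t. f t \<noteq> \<zero>}" for t
    using f by (simp_all add: V_def free_superalgebra_carrier_iff)
  have "P (?r S) \<and> ?r S \<in> carrier V" if "finite S" "S \<subseteq> {t. f t \<noteq> \<zero>}" for S
    using that
  proof (induction S rule: finite_induct)
    case empty
    then show ?case using zero by (simp add: V_def free_superalgebra_simps free_superalgebra_carrier_iff)
  next
    case (insert t S)
    have t: "f t \<noteq> \<zero>" "letters t \<subseteq> X" using insert.prems fc by auto
    have u: "f t \<odot>\<^bsub>V\<^esub> unit_family R t \<in> carrier V"
      using fc t by (simp add: V_def free_superalgebra_smult_closed unit_family_carrier)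
    have eq: "?r (insert t S) = ?r S \<oplus>\<^bsub>V\<^esub> f t \<odot>\<^bsub>V\<^esub> unit_family R t"
      using fc insert.hyps by (auto simp: V_def free_superalgebra_simps unit_family_def fun_eq_iff)
    have S: "P (?r S)" "?r S \<in> carrier V" using insert by auto
    show ?case unfolding eq
      using add[OF S(2) u S(1) unit[OF fc(1) t]] free_superalgebra_add_closed S(2) u
      by (simp add: V_def)
  qed
  moreover have "?r {t. f t \<noteq> \<zero>} = f" by auto
  ultimately show ?thesis using fin by (metis order_refl)
qed

end

section \<open>Lie relators and the ideal they generate\<close>

lemma (in superalgebra) koszul_closed: "x \<in> carrier A \<Longrightarrow> koszul A a b x \<in> carrier A"
  by (simp add: koszul_def)

lemma (in superalgebra) lie_relators_closed: "lie_relators A \<subseteq> carrier A"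
  unfolding lie_relators_def super_jacobi_def
  by (auto intro!: bracket_closed koszul_closed dest: part_closed)

lemma (in superalgebra) two_sided_ideal_hull:
  assumes "S \<subseteq> carrier A"
  shows "two_sided_ideal K A (two_sided_ideal K A hull S)" (is "two_sided_ideal K A ?I")
proof -
  have "two_sided_ideal K A (carrier A)"
    by (simp add: two_sided_ideal_def carrier_is_submodule bracket_closed)
  then have sub: "?I \<subseteq> carrier A" using assms by (intro hull_minimal)
  have "submodule ?I K A"
    by (rule submoduleI[OF sub])
      (auto simp: hull_def two_sided_ideal_def submodule_zero intro: submoduleE)
  then show ?thesis by (auto simp: two_sided_ideal_def hull_def)
qed

context superalgebra_homomorphism
begin

lemma kernel_ideal: "two_sided_ideal K A (a_kernel A B h)"
  using kernel_submodule
  by (simp add: two_sided_ideal_def)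
    (simp add: kernel_eq h_bracket h_closed dom.bracket_closed cod.bracket_zero_left cod.bracket_zero_right)

lemma h_koszul: "x \<in> carrier A \<Longrightarrow> h (koszul A a b x) = koszul B a b (h x)"
  by (simp add: koszul_def h_uminus)

text \<open>A homomorphism commutes with brackets and signs, so it sends each relator to the same
  expression in \<open>B\<close>, where it vanishes by the axioms. As the kernel is an ideal, it
  then contains the whole ideal generated by the relators.\<close>

lemma lie_relators_in_kernel:
  assumes "lie_superalgebra K B"
  shows "lie_relators A \<subseteq> a_kernel A B h"
proof
  interpret B: lie_superalgebra K B by fact
  fix r assume r: "r \<in> lie_relators A"
  then have "h r = \<zero>\<^bsub>B\<^esub>"
    unfolding lie_relators_def
  proof (elim UnE CollectE exE conjE)
    fix x y a b assume xy: "x \<in> part A a" "y \<in> part A b"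
      and r_eq: "r = \<langle>x, y\<rangle>\<^bsub>A\<^esub> \<oplus>\<^bsub>A\<^esub> koszul A a b \<langle>y, x\<rangle>\<^bsub>A\<^esub>"
    note c = dom.part_closed[OF xy(1)] dom.part_closed[OF xy(2)]
    have "h r = \<langle>h x, h y\<rangle>\<^bsub>B\<^esub> \<oplus>\<^bsub>B\<^esub> koszul B a b \<langle>h y, h x\<rangle>\<^bsub>B\<^esub>"
      unfolding r_eq using c by (simp add: h_add h_koszul h_bracket dom.bracket_closed dom.koszul_closed)
    also have "\<dots> = \<zero>\<^bsub>B\<^esub>"
      using c B.super_skew[OF h_part[OF xy(1)] h_part[OF xy(2)]]
      by (simp add: cod.M.l_neg h_closed cod.bracket_closed cod.koszul_closed)
    finally show ?thesis .
  next
    fix x y z a b c assume xyz: "x \<in> part A a" "y \<in> part A b" "z \<in> part A c"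
      and r_eq: "r = super_jacobi A a b c x y z"
    note cl = xyz[THEN dom.part_closed]
    have "h r = super_jacobi B a b c (h x) (h y) (h z)"
      unfolding r_eq super_jacobi_def using cl
      by (simp add: h_add h_koszul h_bracket dom.bracket_closed dom.koszul_closed)
    then show ?thesis using B.super_jacobi xyz[THEN h_part] by simp
  qed
  then show "r \<in> a_kernel A B h" using r dom.lie_relators_closed by (auto simp: kernel_eq)
qed

end

section \<open>Evaluation homomorphisms and lifting from a free Lie superalgebra\<close>

primrec eval_bracketing ::
    "('a, 'v, 'm) superalgebra_scheme \<Rightarrow> ('x \<Rightarrow> 'v) \<Rightarrow> 'x bracketing \<Rightarrow> 'v" where
  "eval_bracketing A c (Letter x) = c x"
| "eval_bracketing A c (Bracketing s t) = \<langle>eval_bracketing A c s, eval_bracketing A c t\<rangle>\<^bsub>A\<^esub>"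

definition eval_free ::
    "('a, 'k) ring_scheme \<Rightarrow> ('a, 'v, 'm) superalgebra_scheme \<Rightarrow> ('x \<Rightarrow> 'v)
      \<Rightarrow> ('x bracketing \<Rightarrow> 'a) \<Rightarrow> 'v" where
  "eval_free K A c f = (\<Oplus>\<^bsub>A\<^esub>t\<in>{t. f t \<noteq> \<zero>\<^bsub>K\<^esub>}. f t \<odot>\<^bsub>A\<^esub> eval_bracketing A c t)"

text \<open>The universal property before the Lie identities are imposed: any degree-preserving
  choice of values for the letters extends to a homomorphism into an arbitrary graded
  algebra.\<close>

lemma (in superalgebra)
  fixes X :: "'x set" and d :: "'x \<Rightarrow> bit"
  assumes c: "\<And>x. x \<in> X \<Longrightarrow> c x \<in> part A (d x)"
  shows eval_free_hom: "eval_free K A c \<in> superalgebra_hom K (free_superalgebra K X d) A"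
    and eval_free_unit: "letters t \<subseteq> X \<Longrightarrow> eval_free K A c (unit_family K t) = eval_bracketing A c t"
proof -
  let ?V = "free_superalgebra K X d" and ?e = "eval_bracketing A c" and ?E = "eval_free K A c"
  interpret V: superalgebra K ?V by (rule K.free_superalgebra_superalgebra)
  have e_part: "?e t \<in> part A (degree d t)" if "letters t \<subseteq> X" for t
    using that
  proof (induction t)
    case (Bracketing s t)
    then show ?case unfolding eval_bracketing.simps degree.simps by (intro bracket_graded) simp_all
  qed (simp add: c)
  then have e: "?e t \<in> carrier A" if "letters t \<subseteq> X" for t using that part_closed by blast
  \<comment> \<open>The supports of \<open>f\<close>, \<open>g\<close> and their sum differ.
    Enlarging the index set by zero terms allows all three sums to be taken over a common finite
    set.\<close>
  have E: "?E f = (\<Oplus>\<^bsub>A\<^esub>t\<in>S. f t \<odot>\<^bsub>A\<^esub> ?e t)"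
    if "f \<in> carrier ?V" "finite S" "{t. f t \<noteq> \<zero>\<^bsub>K\<^esub>} \<subseteq> S" "\<And>t. t \<in> S \<Longrightarrow> letters t \<subseteq> X" for f S
    unfolding eval_free_def
    by (rule M.add.finprod_mono_neutral_cong_left)
      (use that e in \<open>auto simp: free_superalgebra_carrier_iff\<close>)
  have E_add: "?E (f \<oplus>\<^bsub>?V\<^esub> g) = ?E f \<oplus>\<^bsub>A\<^esub> ?E g" if f: "f \<in> carrier ?V" and g: "g \<in> carrier ?V" for f g
  proof -
    let ?S = "{t. f t \<noteq> \<zero>\<^bsub>K\<^esub>} \<union> {t. g t \<noteq> \<zero>\<^bsub>K\<^esub>}"
    have S: "finite ?S" "\<And>t. t \<in> ?S \<Longrightarrow> letters t \<subseteq> X"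
      using f g by (auto simp: free_superalgebra_carrier_iff)
    have fg: "f t \<in> carrier K" "g t \<in> carrier K" for t
      using f g by (simp_all add: free_superalgebra_carrier_iff)
    have "?E (f \<oplus>\<^bsub>?V\<^esub> g) = (\<Oplus>\<^bsub>A\<^esub>t\<in>?S. (f \<oplus>\<^bsub>?V\<^esub> g) t \<odot>\<^bsub>A\<^esub> ?e t)"
      by (rule E[OF _ S(1) _ S(2)]) (use f g in \<open>simp, auto simp: free_superalgebra_simps\<close>)
    also have "\<dots> = (\<Oplus>\<^bsub>A\<^esub>t\<in>?S. f t \<odot>\<^bsub>A\<^esub> ?e t \<oplus>\<^bsub>A\<^esub> g t \<odot>\<^bsub>A\<^esub> ?e t)"
      by (rule M.finsum_cong') (use S(2) fg e in \<open>auto simp: free_superalgebra_simps smult_l_distr\<close>)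
    also have "\<dots> = (\<Oplus>\<^bsub>A\<^esub>t\<in>?S. f t \<odot>\<^bsub>A\<^esub> ?e t) \<oplus>\<^bsub>A\<^esub> (\<Oplus>\<^bsub>A\<^esub>t\<in>?S. g t \<odot>\<^bsub>A\<^esub> ?e t)"
      by (rule M.finsum_addf) (use S(2) fg e in auto)
    finally show ?thesis using E[OF f S(1) _ S(2)] E[OF g S(1) _ S(2)] by auto
  qed
  have E_smult: "?E (k \<odot>\<^bsub>?V\<^esub> f) = k \<odot>\<^bsub>A\<^esub> ?E f" if k: "k \<in> carrier K" and f: "f \<in> carrier ?V" for k f
  proof -
    let ?S = "{t. f t \<noteq> \<zero>\<^bsub>K\<^esub>}"
    have S: "finite ?S" "\<And>t. t \<in> ?S \<Longrightarrow> letters t \<subseteq> X" and fc: "f t \<in> carrier K" for t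
      using f by (auto simp: free_superalgebra_carrier_iff)
    have "?E (k \<odot>\<^bsub>?V\<^esub> f) = (\<Oplus>\<^bsub>A\<^esub>t\<in>?S. (k \<odot>\<^bsub>?V\<^esub> f) t \<odot>\<^bsub>A\<^esub> ?e t)"
      by (rule E[OF _ S(1) _ S(2)]) (use k f in \<open>simp, auto simp: free_superalgebra_simps\<close>)
    also have "\<dots> = (\<Oplus>\<^bsub>A\<^esub>t\<in>?S. k \<odot>\<^bsub>A\<^esub> (f t \<odot>\<^bsub>A\<^esub> ?e t))"
      by (rule M.finsum_cong') (use S(2) k fc e in \<open>auto simp: free_superalgebra_simps smult_assoc1\<close>)
    also have "\<dots> = k \<odot>\<^bsub>A\<^esub> (\<Oplus>\<^bsub>A\<^esub>t\<in>?S. f t \<odot>\<^bsub>A\<^esub> ?e t)"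
      by (rule finsum_smult_ldistr[symmetric]) (use S k fc e in auto)
    finally show ?thesis unfolding eval_free_def .
  qed
  show E_unit: "?E (unit_family K t) = ?e t" if t: "letters t \<subseteq> X" for t
  proof -
    have "?E (unit_family K t) = (\<Oplus>\<^bsub>A\<^esub>s\<in>{t}. unit_family K t s \<odot>\<^bsub>A\<^esub> ?e s)"
      by (rule E) (use t in \<open>auto simp: K.unit_family_carrier, auto simp: unit_family_def split: if_splits\<close>)
    also have "\<dots> = ?e t"
      using e[OF t] M.finsum_insert[of "{}" t "\<lambda>s. unit_family K t s \<odot>\<^bsub>A\<^esub> ?e s"]
      by (simp add: unit_family_def)
    finally show ?thesis .
  qed
  have unit_c: "unit_family K t \<in> carrier ?V" if "letters t \<subseteq> X" for t
    using that by (rule K.unit_family_carrier)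
  have E_zero: "?E \<zero>\<^bsub>?V\<^esub> = \<zero>\<^bsub>A\<^esub>"
    by (simp add: eval_free_def free_superalgebra_simps)
  have E_closed: "?E f \<in> carrier A" if "f \<in> carrier ?V" for f
    using that
  proof (induction rule: K.free_superalgebra_induct)
  qed (simp_all add: E_zero E_add E_smult unit_c E_unit e)
  \<comment> \<open>Both sides are bilinear, so an induction on \<open>f\<close> and a nested one on
    \<open>g\<close> leave two basis vectors, whose bracket is the basis vector of the composed
    bracketing.\<close>
  have E_bracket: "?E \<langle>f, g\<rangle>\<^bsub>?V\<^esub> = \<langle>?E f, ?E g\<rangle>\<^bsub>A\<^esub>"
    if f: "f \<in> carrier ?V" and g: "g \<in> carrier ?V" for f g
    using f
  proof (induction rule: K.free_superalgebra_induct)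
    case zero
    then show ?case using g by (simp add: E_zero V.bracket_zero_left bracket_zero_left E_closed)
  next
    case (add f f')
    then show ?case using g
      by (simp add: E_add V.bracket_add_left bracket_add_left E_closed V.bracket_closed)
  next
    case (unit k t)
    note t = unit(1,3)
    let ?u = "unit_family K t"
    have "?E \<langle>?u, g\<rangle>\<^bsub>?V\<^esub> = \<langle>?e t, ?E g\<rangle>\<^bsub>A\<^esub>"
      using g
    proof (induction rule: K.free_superalgebra_induct)
      case zero
      then show ?case using t by (simp add: E_zero V.bracket_zero_right bracket_zero_right e unit_c)
    next
      case (add g g')
      then show ?case using t
        by (simp add: E_add V.bracket_add_right bracket_add_right E_closed V.bracket_closed unit_c e)
    next
      case (unit l s)
      have "letters (Bracketing t s) \<subseteq> X" using unit(3) t by simp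
      then have "?E (l \<odot>\<^bsub>?V\<^esub> unit_family K (Bracketing t s)) = l \<odot>\<^bsub>A\<^esub> ?e (Bracketing t s)"
        using unit(1) by (simp only: E_smult E_unit unit_c)
      then show ?case using unit t
        by (simp add: V.bracket_smult_right bracket_smult_right E_smult E_unit unit_c e
            K.unit_family_bracket)
    qed
    then show ?case using t g
      by (simp add: V.bracket_smult_left bracket_smult_left E_smult E_unit unit_c e E_closed V.bracket_closed)
  qed
  have E_part: "?E f \<in> part A a" if f: "f \<in> part ?V a" for f a
  proof -
    have fc: "f \<in> carrier ?V" and deg: "\<And>t. f t \<noteq> \<zero>\<^bsub>K\<^esub> \<Longrightarrow> degree d t = a"
      using f by (simp_all add: free_superalgebra_part_iff)
    show ?thesis
      using fc
    proof (induction rule: K.free_superalgebra_induct)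
      case (unit k t)
      then show ?case using e_part[OF unit(3)] by (simp add: E_smult E_unit unit_c part_smult deg)
    qed (simp_all add: E_zero part_zero E_add part_add)
  qed
  show "?E \<in> superalgebra_hom K ?V A"
    by (rule superalgebra_homI) (simp_all add: E_closed E_add E_smult E_part E_bracket)
qed

text \<open>Free Lie superalgebras are projective. The lift is first built on the nonassociative
  algebra, where the letters can be sent anywhere of the right degree, and descends because
  \<open>E\<close> satisfies the Lie identities.\<close>

lemma free_lie_superalgebra_lift:
  assumes free: "is_free_on K F X d"
    and "lie_superalgebra K L" "lie_superalgebra K E"
    and p: "p \<in> superalgebra_hom K F L" and f: "f \<in> superalgebra_hom K E L"
    and f_surj: "f ` carrier E = carrier L"
  obtains \<phi> where "\<phi> \<in> superalgebra_hom K F E" "\<And>x. x \<in> carrier F \<Longrightarrow> f (\<phi> x) = p x"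
proof -
  interpret F: lie_superalgebra K F using free by (simp add: is_free_on_def)
  interpret L: lie_superalgebra K L by fact
  interpret E: lie_superalgebra K E by fact
  let ?V = "free_superalgebra K X d"
  let ?I = "two_sided_ideal K ?V hull lie_relators ?V"
  interpret V: superalgebra K ?V by (rule F.K.free_superalgebra_superalgebra)
  interpret f: superalgebra_homomorphism K E L f by unfold_locales (rule f)
  have I: "two_sided_ideal K ?V ?I" by (rule V.two_sided_ideal_hull[OF V.lie_relators_closed])
  then have I_sub: "submodule ?I K ?V" by (simp add: two_sided_ideal_def)
  have FL: "free_lie_superalgebra K X d = superalgebra_quotient ?V ?I"
    by (simp add: free_lie_superalgebra_def Let_def)
  obtain \<theta> where "\<theta> \<in> superalgebra_iso K (superalgebra_quotient ?V ?I) F"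
    using free by (auto simp: is_free_on_def FL)
  then have \<theta>: "\<theta> \<in> superalgebra_hom K (superalgebra_quotient ?V ?I) F"
    and \<theta>_bij: "bij_betw \<theta> (carrier (superalgebra_quotient ?V ?I)) (carrier F)"
    by (simp_all add: superalgebra_iso_def)
  \<comment> \<open>\<open>F\<close> is only isomorphic to the constructed quotient. This is the
    projection followed by such an isomorphism, so that \<open>F\<close> itself appears as a
    quotient of \<open>?V\<close>.\<close>
  define q where "q g = \<theta> (?I +>\<^bsub>?V\<^esub> g)" for g
  have q: "q \<in> superalgebra_hom K ?V F"
    unfolding q_def[abs_def] by (rule superalgebra_hom_compose[OF V.quotient_hom[OF I] \<theta>])
  interpret q: superalgebra_homomorphism K ?V F q by unfold_locales (rule q)
  have q_surj: "q ` carrier ?V = carrier F"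
    using \<theta>_bij V.quotient_surj[OF I] unfolding q_def[abs_def] bij_betw_def by (metis image_image)
  have pq: "(\<lambda>g. p (q g)) \<in> superalgebra_hom K ?V L"
    by (rule superalgebra_hom_compose[OF q p])
  interpret pq: superalgebra_homomorphism K ?V L "\<lambda>g. p (q g)" by unfold_locales (rule pq)
  \<comment> \<open>The preimage of a letter must be homogeneous of the degree of that letter, which
    \<open>part_surj\<close> guarantees.\<close>
  have "\<exists>c. c \<in> part E (d x) \<and> f c = p (q (unit_family K (Letter x)))" if "x \<in> X" for x
  proof -
    have "unit_family K (Letter x) \<in> part ?V (d x)"
      using F.K.unit_family_part[where t = "Letter x" and X = X and d = d] that by simp
    then have "p (q (unit_family K (Letter x))) \<in> f ` part E (d x)"
      using pq.h_part f.part_surj[OF f_surj] by blast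
    then show ?thesis by auto
  qed
  then obtain c where c: "\<And>x. x \<in> X \<Longrightarrow> c x \<in> part E (d x)"
    and fc: "\<And>x. x \<in> X \<Longrightarrow> f (c x) = p (q (unit_family K (Letter x)))" by metis
  let ?\<Phi> = "eval_free K E c"
  have \<Phi>: "?\<Phi> \<in> superalgebra_hom K ?V E" by (rule E.eval_free_hom[OF c])
  interpret \<Phi>: superalgebra_homomorphism K ?V E ?\<Phi> by unfold_locales (rule \<Phi>)
  have f\<Phi>: "(\<lambda>g. f (?\<Phi> g)) \<in> superalgebra_hom K ?V L"
    by (rule superalgebra_hom_compose[OF \<Phi> f])
  interpret f\<Phi>: superalgebra_homomorphism K ?V L "\<lambda>g. f (?\<Phi> g)" by unfold_locales (rule f\<Phi>)
  \<comment> \<open>Agreement on the letters propagates to all bracketings, as both composites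
    preserve brackets, and from there to the whole algebra by linearity.\<close>
  have letters_eq: "f (?\<Phi> (unit_family K t)) = p (q (unit_family K t))" if "letters t \<subseteq> X" for t
    using that
  proof (induction t)
    case (Letter x)
    then show ?case using E.eval_free_unit[where t = "Letter x", OF c] fc by simp
  next
    case (Bracketing s t)
    then have "unit_family K s \<in> carrier ?V" "unit_family K t \<in> carrier ?V"
      by (simp_all add: F.K.unit_family_carrier)
    then show ?case
      using f\<Phi>.h_bracket pq.h_bracket Bracketing
      by (simp add: F.K.unit_family_bracket[where r = s and s = t and X = X and d = d, symmetric])
  qed
  have f\<Phi>_eq: "f (?\<Phi> g) = p (q g)" if "g \<in> carrier ?V" for g
    using that
  proof (induction rule: F.K.free_superalgebra_induct)
    case zero
    show ?case using f\<Phi>.h_zero pq.h_zero by simp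
  next
    case (add g h)
    then show ?case using f\<Phi>.h_add pq.h_add by simp
  next
    case (unit k t)
    then show ?case
      using f\<Phi>.h_smult[of k "unit_family K t"] pq.h_smult[of k "unit_family K t"] unit letters_eq
        F.K.unit_family_carrier[where t = t and X = X and d = d] by simp
  qed
  have "?I \<subseteq> a_kernel ?V E ?\<Phi>"
    by (rule hull_minimal[where S = "two_sided_ideal K ?V",
        OF \<Phi>.lie_relators_in_kernel[OF assms(3)] \<Phi>.kernel_ideal])
  then have "?\<Phi> x = ?\<Phi> y" if "x \<in> carrier ?V" "y \<in> carrier ?V" "q x = q y" for x y
  proof -
    \<comment> \<open>Injectivity of the isomorphism \<open>\<theta>\<close> turns equal values of
      \<open>q\<close> into congruence modulo the ideal of relators, and that ideal is killed by the
      evaluation.\<close>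
    have "?I +>\<^bsub>?V\<^esub> x = ?I +>\<^bsub>?V\<^esub> y"
    proof (rule inj_onD[OF bij_betw_imp_inj_on[OF \<theta>_bij]])
      show "\<theta> (?I +>\<^bsub>?V\<^esub> x) = \<theta> (?I +>\<^bsub>?V\<^esub> y)" using that by (simp add: q_def)
    qed (use that in \<open>auto simp flip: V.quotient_surj[OF I]\<close>)
    then have "x \<ominus>\<^bsub>?V\<^esub> y \<in> a_kernel ?V E ?\<Phi>"
      using V.coset_eq_iff[OF I_sub that(1,2)] \<open>?I \<subseteq> a_kernel ?V E ?\<Phi>\<close> by blast
    then show ?thesis using \<Phi>.h_eq_iff[OF that(1,2)] by (simp add: \<Phi>.kernel_eq)
  qed
  then obtain \<phi> where \<phi>: "\<phi> \<in> superalgebra_hom K F E" "\<And>g. g \<in> carrier ?V \<Longrightarrow> \<phi> (q g) = ?\<Phi> g"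
    using V.hom_factor[OF q \<Phi> q_surj q.part_surj[OF q_surj]] by metis
  moreover have "f (\<phi> x) = p x" if "x \<in> carrier F" for x
    using that \<phi>(2) f\<Phi>_eq unfolding q_surj[symmetric] by auto
  ultimately show thesis using that by blast
qed

section \<open>Covers and isoclinism\<close>

lemma (in superalgebra) coset_eq_self_iff:
  assumes "submodule I K A" "x \<in> carrier A"
  shows "I +>\<^bsub>A\<^esub> x = I \<longleftrightarrow> x \<in> I"
proof
  show "I +>\<^bsub>A\<^esub> x = I" if "x \<in> I"
    using M.a_coset_join2[OF assms(2) submodule.axioms(1)[OF assms(1)] that] .
  have "x \<in> I +>\<^bsub>A\<^esub> x"
    using assms by (simp add: mem_coset_iff a_minus_def M.r_neg submodule_zero)
  then show "x \<in> I" if "I +>\<^bsub>A\<^esub> x = I" using that by simp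
qed

lemma (in superalgebra) submodule_restrict_to:
  assumes "superalgebra K (restrict_to A H)" "submodule G K A" "G \<subseteq> H"
  shows "submodule G K (restrict_to A H)"
proof -
  interpret r: superalgebra K "restrict_to A H" by fact
  have [simp]: "carrier (restrict_to A H) = H" "add (restrict_to A H) = add A"
    "smult (restrict_to A H) = smult A" "zero (restrict_to A H) = zero A"
    by (simp_all add: restrict_to_def)
  show ?thesis
  proof (rule r.submoduleI)
    \<comment> \<open>Negation in the restriction refers to the smaller carrier. Written as
      multiplication by minus one, it is an operation of \<open>A\<close> again.\<close>
    show "\<ominus>\<^bsub>restrict_to A H\<^esub> x \<in> G" if "x \<in> G" for x
      using that assms(3) r.uminus_eq_smult[of x] submoduleE(4)[OF assms(2), of "\<ominus>\<^bsub>K\<^esub> \<one>\<^bsub>K\<^esub>" x] by auto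
  qed (use assms in \<open>auto simp: submodule_zero intro: submoduleE\<close>)
qed

text \<open>Central summands drop out of brackets, so being onto modulo the centre already gives
  every bracket of \<open>B\<close> as an image. This applies before \<open>h\<close> is known to be
  surjective, and for stem extensions it is what yields surjectivity.\<close>

lemma (in superalgebra_homomorphism) derived_image_mod_center:
  assumes "lie_superalgebra K B"
    and gen: "\<And>y. y \<in> carrier B \<Longrightarrow> \<exists>x\<in>carrier A. \<exists>z\<in>lie_center B. y = h x \<oplus>\<^bsub>B\<^esub> z"
  shows "derived K B \<subseteq> h ` derived K A"
proof -
  interpret B: lie_superalgebra K B by fact
  have "\<langle>y, y'\<rangle>\<^bsub>B\<^esub> \<in> h ` derived K A" if "y \<in> carrier B" "y' \<in> carrier B" for y y'
  proof -
    obtain x z where x: "x \<in> carrier A" and z: "z \<in> lie_center B" and y: "y = h x \<oplus>\<^bsub>B\<^esub> z"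
      using gen[OF \<open>y \<in> carrier B\<close>] by blast
    obtain x' z' where x': "x' \<in> carrier A" and z': "z' \<in> lie_center B" and y': "y' = h x' \<oplus>\<^bsub>B\<^esub> z'"
      using gen[OF \<open>y' \<in> carrier B\<close>] by blast
    have zc: "z \<in> carrier B" "z' \<in> carrier B" using z z' by (simp_all add: lie_center_def)
    have 0: "\<langle>z, y'\<rangle>\<^bsub>B\<^esub> = \<zero>\<^bsub>B\<^esub>" "\<langle>h x, z'\<rangle>\<^bsub>B\<^esub> = \<zero>\<^bsub>B\<^esub>"
      using z that B.center_bracket_right[OF z' h_closed[OF x]] by (simp_all add: lie_center_def)
    have "\<langle>y, y'\<rangle>\<^bsub>B\<^esub> = \<langle>h x, y'\<rangle>\<^bsub>B\<^esub>"
      unfolding y using x zc(1) that(2) 0(1) by (simp add: cod.bracket_add_left h_closed cod.bracket_closed)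
    also have "\<dots> = \<langle>h x, h x'\<rangle>\<^bsub>B\<^esub>"
      unfolding y' using x x' zc(2) 0(2) by (simp add: cod.bracket_add_right h_closed cod.bracket_closed)
    finally have "\<langle>y, y'\<rangle>\<^bsub>B\<^esub> = h \<langle>x, x'\<rangle>\<^bsub>A\<^esub>" using x x' by (simp add: h_bracket)
    then show ?thesis using dom.bracket_in_derived[OF x x'] by blast
  qed
  then show ?thesis
    unfolding derived_def[of K B]
    by (intro cod.bracket_span_minimal image_submodule dom.derived_submodule)
qed

lemma (in superalgebra_homomorphism) derived_image:
  assumes "lie_superalgebra K B" and surj: "h ` carrier A = carrier B"
  shows "h ` derived K A = derived K B"
proof
  interpret B: lie_superalgebra K B by fact
  have zero: "\<zero>\<^bsub>B\<^esub> \<in> lie_center B" using cod.bracket_zero_left by (simp add: lie_center_def)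
  have "\<exists>x\<in>carrier A. \<exists>z\<in>lie_center B. y = h x \<oplus>\<^bsub>B\<^esub> z" if y: "y \<in> carrier B" for y
  proof -
    obtain x where x: "x \<in> carrier A" "y = h x" using y unfolding surj[symmetric] by blast
    have "y = h x \<oplus>\<^bsub>B\<^esub> \<zero>\<^bsub>B\<^esub>" unfolding x(2)[symmetric] using cod.M.r_zero[OF y] by (rule sym)
    then show ?thesis using x(1) zero by blast
  qed
  then show "derived K B \<subseteq> h ` derived K A" by (rule derived_image_mod_center[OF assms(1)])
  have "bracket_span K A (carrier A) (carrier A) \<subseteq> {x \<in> carrier A. h x \<in> derived K B}"
  proof (rule dom.bracket_span_minimal)
    show "submodule {x \<in> carrier A. h x \<in> derived K B} K A"
      by (rule dom.submoduleI)
        (auto simp: h_zero h_uminus h_add h_smult cod.submodule_zero[OF cod.derived_submodule]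
          intro: cod.submoduleE[OF cod.derived_submodule])
  qed (simp add: dom.bracket_closed h_bracket h_closed cod.bracket_in_derived)
  then show "h ` derived K A \<subseteq> derived K B" unfolding derived_def[of K A] by blast
qed

text \<open>The right-hand side of the last property mentions only the presentation, so the lifts to
  different covers have the same kernel on the derived algebra of \<open>F\<close>. This is all that
  the comparison of two covers requires.\<close>

lemma stem_cover_lift:
  fixes K :: "('a, 'k) ring_scheme" and p :: "'f \<Rightarrow> 'l" and F :: "('a, 'f, 'm) superalgebra_scheme" and L :: "('a, 'l, 'n) superalgebra_scheme"
    and E :: "('a, 'e, 'o) superalgebra_scheme"
  defines "N \<equiv> bracket_span K F (carrier F) (a_kernel F L p)"
  assumes pres: "is_free_presentation K X d F p L"
    and dim: "has_superdim K (schur_multiplier K F p L) m n"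
    and cover: "is_stem_cover K (schur_multiplier K F p L) E f L"
  obtains \<phi> where "\<phi> \<in> superalgebra_hom K F E" "\<phi> ` carrier F = carrier E"
    "\<And>x. x \<in> derived K F \<Longrightarrow> \<phi> x = \<zero>\<^bsub>E\<^esub> \<longleftrightarrow> x \<in> N"
proof -
  have free: "is_free_on K F X d" and F: "lie_superalgebra K F" and L: "lie_superalgebra K L"
    and p: "p \<in> superalgebra_hom K F L" and p_surj: "p ` carrier F = carrier L"
    using pres unfolding is_free_presentation_def is_extension_def by blast+
  have E: "lie_superalgebra K E" and f: "f \<in> superalgebra_hom K E L"
    and f_surj: "f ` carrier E = carrier L"
    and stem: "a_kernel E L f \<subseteq> lie_center E \<inter> derived K E"
    using cover unfolding is_stem_cover_def is_stem_extension_def is_extension_def by blast+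
  interpret F: lie_superalgebra K F by (rule F)
  interpret L: lie_superalgebra K L by (rule L)
  interpret E: lie_superalgebra K E by (rule E)
  interpret p: superalgebra_homomorphism K F L p by unfold_locales (rule p)
  interpret f: superalgebra_homomorphism K E L f by unfold_locales (rule f)
  obtain \<phi> where \<phi>: "\<phi> \<in> superalgebra_hom K F E" and f\<phi>: "\<And>x. x \<in> carrier F \<Longrightarrow> f (\<phi> x) = p x"
    using free_lie_superalgebra_lift[OF free L E p f f_surj] by metis
  interpret \<phi>: superalgebra_homomorphism K F E \<phi> by unfold_locales (rule \<phi>)
  let ?R = "a_kernel F L p" and ?M = "a_kernel E L f"

  \<comment> \<open>Since \<open>f\<close> after \<open>\<phi>\<close> is \<open>p\<close>, which is
    onto, every \<open>c\<close> has the same image in \<open>L\<close> as some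
    \<open>\<phi> x\<close>; the error lies in the kernel of \<open>f\<close>.\<close>
  have gen: "\<exists>x\<in>carrier F. \<exists>z\<in>?M. c = \<phi> x \<oplus>\<^bsub>E\<^esub> z" if c: "c \<in> carrier E" for c
  proof -
    obtain x where x: "x \<in> carrier F" "f c = p x" using p_surj f.h_closed[OF c] by blast
    then have "c \<ominus>\<^bsub>E\<^esub> \<phi> x \<in> ?M"
      using c f\<phi>[OF x(1)] f.h_eq_iff[OF c \<phi>.h_closed[OF x(1)]] by (simp add: f.kernel_eq \<phi>.h_closed)
    moreover have "c = \<phi> x \<oplus>\<^bsub>E\<^esub> (c \<ominus>\<^bsub>E\<^esub> \<phi> x)"
      using c \<phi>.h_closed[OF x(1)] by (simp add: a_minus_def E.M.a_lcomm[of "\<phi> x"] E.M.r_neg)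
    ultimately show ?thesis using x(1) by blast
  qed
  have der: "derived K E \<subseteq> \<phi> ` derived K F"
    using gen stem by (intro \<phi>.derived_image_mod_center[OF E]) blast
  have surj: "\<phi> ` carrier F = carrier E"
  proof
    show "carrier E \<subseteq> \<phi> ` carrier F"
    proof
      fix c assume "c \<in> carrier E"
      then obtain x z where x: "x \<in> carrier F" and z: "z \<in> ?M" and c: "c = \<phi> x \<oplus>\<^bsub>E\<^esub> z"
        using gen by blast
      \<comment> \<open>The stem condition places the error term in the derived algebra of
        \<open>E\<close>, which is already known to lie in the image of
        \<open>\<phi>\<close>.\<close>
      obtain y where y: "y \<in> carrier F" "z = \<phi> y" using z stem der F.derived_closed by blast
      show "c \<in> \<phi> ` carrier F"
        using x y c \<phi>.h_add[OF x y(1)] by (intro image_eqI[of _ _ "x \<oplus>\<^bsub>F\<^esub> y"]) simp_all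
    qed
  qed (use \<phi>.h_closed in blast)

  have R_sub: "x \<in> ?R \<Longrightarrow> x \<in> carrier F" for x by (simp add: p.kernel_eq)
  have \<phi>R: "\<phi> x \<in> ?M" if "x \<in> ?R" for x
    using that f\<phi> by (simp add: p.kernel_eq f.kernel_eq \<phi>.h_closed)
  have N: "graded_subspace K F N"
    unfolding N_def by (intro F.graded_subspace_bracket_span F.graded_subspace_carrier p.kernel_graded)
  then have N_sub: "submodule N K F" by (simp add: graded_subspace_def)
  have N_ker: "N \<subseteq> a_kernel F E \<phi>"
    unfolding N_def
  proof (rule F.bracket_span_minimal[OF _ \<phi>.kernel_submodule])
    fix x r assume x: "x \<in> carrier F" and r: "r \<in> ?R"
    have "\<langle>\<phi> x, \<phi> r\<rangle>\<^bsub>E\<^esub> = \<zero>\<^bsub>E\<^esub>"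
      using E.center_bracket_right \<phi>R[OF r] stem \<phi>.h_closed[OF x] by blast
    then show "\<langle>x, r\<rangle>\<^bsub>F\<^esub> \<in> a_kernel F E \<phi>"
      using x R_sub[OF r] by (simp add: \<phi>.kernel_eq F.bracket_closed \<phi>.h_bracket)
  qed

  define H where "H = derived K F \<inter> ?R"
  have H_graded: "graded_subspace K F H"
    unfolding H_def by (intro F.graded_subspace_Int F.derived_graded p.kernel_graded)
  then have H_sub: "submodule H K F" by (simp add: graded_subspace_def)
  have FR: "\<langle>x, r\<rangle>\<^bsub>F\<^esub> \<in> H" if "x \<in> carrier F" "r \<in> ?R" for x r
    using that p.kernel_ideal R_sub
    by (auto simp: H_def F.bracket_in_derived two_sided_ideal_def)
  have N_H: "N \<subseteq> H" unfolding N_def by (rule F.bracket_span_minimal[OF FR H_sub])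
  let ?A = "restrict_to F H"
  interpret A: superalgebra K ?A
    using FR by (intro F.superalgebra_restrict_to H_graded) (auto simp: H_def R_sub)
  have A_simps [simp]: "carrier ?A = H" "add ?A = add F" "smult ?A = smult F" "bracket ?A = bracket F"
    "zero ?A = zero F" by (simp_all add: restrict_to_def)
  have H_F: "x \<in> H \<Longrightarrow> x \<in> carrier F" and H_R: "x \<in> H \<Longrightarrow> x \<in> ?R" for x
    by (simp_all add: H_def R_sub)
  have N_subA: "submodule N K ?A" by (rule F.submodule_restrict_to[OF A.superalgebra_axioms N_sub N_H])
  have "\<langle>x, y\<rangle>\<^bsub>F\<^esub> \<in> N" if "x \<in> carrier F" "y \<in> ?R" for x y
    unfolding N_def using that by (rule F.bracket_in_span)
  then have N_ideal: "two_sided_ideal K ?A N"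
    using N_subA N_H H_F H_R by (auto simp: two_sided_ideal_def)
  let ?Q = "superalgebra_quotient ?A N" and ?\<pi> = "(+>\<^bsub>restrict_to F H\<^esub>) N"
  have Q: "schur_multiplier K F p L = ?Q" by (simp add: schur_multiplier_def H_def N_def Let_def)
  interpret Q: module K ?Q by (rule A.quotient_module[OF N_ideal])
  have \<pi>: "?\<pi> \<in> superalgebra_hom K ?A ?Q" and \<pi>_surj: "?\<pi> ` H = carrier ?Q"
    using A.quotient_hom[OF N_ideal] A.quotient_surj[OF N_ideal] by simp_all

  let ?B = "restrict_to E ?M"
  have B_simps: "carrier ?B = ?M" "smult ?B = smult E" by (simp_all add: restrict_to_def)
  have \<phi>H: "\<phi> ` H = ?M"
  proof
    show "\<phi> ` H \<subseteq> ?M" using \<phi>R by (auto simp: H_def)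
    \<comment> \<open>An element of the kernel has a preimage in the derived algebra of
      \<open>F\<close>, and any preimage lies in \<open>?R\<close> because its image under
      \<open>p\<close> is zero.\<close>
    show "?M \<subseteq> \<phi> ` H"
    proof
      fix z assume z: "z \<in> ?M"
      then obtain x where x: "x \<in> derived K F" "z = \<phi> x" using stem der by blast
      then have "x \<in> ?R" using z f\<phi>[of x] F.derived_closed by (simp add: f.kernel_eq p.kernel_eq)
      then show "z \<in> \<phi> ` H" using x by (simp add: H_def)
    qed
  qed
  \<comment> \<open>The restriction of \<open>\<phi>\<close> to \<open>H\<close> is read with two
    codomains: \<open>E\<close> for comparing values through differences, and the kernel of
    \<open>f\<close> for the map induced on the multiplier.\<close>
  have \<phi>A: "\<phi> \<in> superalgebra_hom K ?A E"
    by (rule superalgebra_homI)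
      (simp_all add: H_F \<phi>.h_closed \<phi>.h_add \<phi>.h_smult \<phi>.h_bracket, simp add: restrict_to_def \<phi>.h_part)
  then interpret \<phi>A: superalgebra_homomorphism K ?A E \<phi> by unfold_locales
  have \<phi>B: "\<phi> \<in> superalgebra_hom K ?A ?B"
    using \<phi>A \<phi>H by (auto simp: superalgebra_hom_def restrict_to_def)
  have fib: "\<phi> x = \<phi> y" if "x \<in> carrier ?A" "y \<in> carrier ?A" "?\<pi> x = ?\<pi> y" for x y
    using that A.coset_eq_iff[OF N_subA, of x y] \<phi>A.h_eq_iff[of x y] N_ker
    by (auto simp: \<phi>.kernel_eq)
  have part: "part ?Q a \<subseteq> ?\<pi> ` part ?A a" for a by (simp add: A.quotient_part)
  obtain \<phi>' where \<phi>': "\<phi>' \<in> superalgebra_hom K ?Q ?B"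
    and "\<And>x. x \<in> carrier ?A \<Longrightarrow> \<phi>' (?\<pi> x) = \<phi> x"
    using A.hom_factor[OF \<pi> \<phi>B A.quotient_surj[OF N_ideal] part fib] by metis
  then have \<phi>'_\<pi>: "\<And>x. x \<in> H \<Longrightarrow> \<phi>' (?\<pi> x) = \<phi> x" by simp
  have "superalgebra_iso K ?B ?Q \<noteq> {}" using cover unfolding is_stem_cover_def Q by (rule conjunct2)
  then obtain \<psi> where "\<psi> \<in> superalgebra_iso K ?B ?Q" by blast
  then have \<psi>: "\<psi> \<in> superalgebra_hom K ?B ?Q" and \<psi>_bij: "bij_betw \<psi> ?M (carrier ?Q)"
    by (simp_all add: superalgebra_iso_def restrict_to_def)
  \<comment> \<open>The unrelated isomorphism \<open>\<psi>\<close> serves only to return from the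
    kernel of \<open>f\<close> to the multiplier, which makes the induced surjection an
    endomorphism.\<close>
  have T: "(\<lambda>S. \<psi> (\<phi>' S)) \<in> superalgebra_hom K ?Q ?Q" by (rule superalgebra_hom_compose[OF \<phi>' \<psi>])
  have \<phi>'_image: "\<phi>' ` carrier ?Q = ?M"
    unfolding \<pi>_surj[symmetric] \<phi>H[symmetric] image_image by (rule image_cong[OF refl \<phi>'_\<pi>])
  have T_surj: "(\<lambda>S. \<psi> (\<phi>' S)) ` carrier ?Q = carrier ?Q"
    using \<psi>_bij unfolding bij_betw_def \<phi>'_image[symmetric] by (simp add: image_image)

  obtain B0 B1 where B: "finite B0" "finite B1" "B0 \<subseteq> part ?Q 0" "B1 \<subseteq> part ?Q 1"
    and span: "lspan K ?Q B0 = part ?Q 0" "lspan K ?Q B1 = part ?Q 1"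
    using dim unfolding has_superdim_def has_dim_def Q by blast
  have "part ?Q a \<subseteq> carrier ?Q" for a
    unfolding A.quotient_part using \<pi>_surj A.part_closed by auto
  then have B_sub: "B0 \<union> B1 \<subseteq> carrier ?Q" using B by blast
  \<comment> \<open>The superdimension supplies finite spanning sets of the two parts separately.
    Their union spans everything, as each class is the sum of the classes of the components of a
    representative.\<close>
  have "carrier ?Q \<subseteq> lspan K ?Q (B0 \<union> B1)"
  proof
    fix S assume "S \<in> carrier ?Q"
    then obtain x where x: "x \<in> H" "S = ?\<pi> x" using \<pi>_surj by blast
    obtain u v where uv: "u \<in> part ?A 0" "v \<in> part ?A (0 + 1)" "x = u \<oplus>\<^bsub>?A\<^esub> v"
      using A.decompose[of x 0] x(1) by auto
    have "?\<pi> u \<in> part ?Q 0" "?\<pi> v \<in> part ?Q 1"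
      using uv(1,2) by (auto simp: A.quotient_part)
    moreover have "part ?Q 0 \<subseteq> lspan K ?Q (B0 \<union> B1)" "part ?Q 1 \<subseteq> lspan K ?Q (B0 \<union> B1)"
      unfolding span[symmetric] lspan_def by (auto intro!: hull_mono simp del: Un_iff)
    ultimately have "?\<pi> u \<oplus>\<^bsub>?Q\<^esub> ?\<pi> v \<in> lspan K ?Q (B0 \<union> B1)"
      using Q.submoduleE(5)[OF Q.lspan_submodule[OF B_sub]] by blast
    then show "S \<in> lspan K ?Q (B0 \<union> B1)"
      using hom_add[OF \<pi>, of u v] uv x(2) A.part_closed by metis
  qed
  then have inj: "S = \<zero>\<^bsub>?Q\<^esub>" if "S \<in> carrier ?Q" "\<psi> (\<phi>' S) = \<zero>\<^bsub>?Q\<^esub>" for S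
    using surjective_endomorphism_injective[OF F.K.field_axioms Q.module_axioms _ B_sub _ T_surj
        hom_add[OF T] hom_smult[OF T] that] B(1,2) by simp

  have "x \<in> N" if x: "x \<in> derived K F" "\<phi> x = \<zero>\<^bsub>E\<^esub>" for x
  proof -
    have "x \<in> ?R"
      using x f\<phi>[of x] F.derived_closed[of x] f.h_zero by (simp add: p.kernel_eq)
    then have xH: "x \<in> H" using x(1) by (simp add: H_def)
    have "\<zero>\<^bsub>E\<^esub> \<in> ?M" by (simp add: f.kernel_eq f.h_zero)
    then have "\<psi> \<zero>\<^bsub>E\<^esub> = \<zero>\<^bsub>?Q\<^esub>"
      using hom_smult[OF \<psi>, of "\<zero>\<^bsub>K\<^esub>" "\<zero>\<^bsub>E\<^esub>"] hom_closed[OF \<psi>, of "\<zero>\<^bsub>E\<^esub>"]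
      by (simp add: B_simps)
    then have "?\<pi> x = \<zero>\<^bsub>?Q\<^esub>" using inj[of "?\<pi> x"] xH \<phi>'_\<pi>[OF xH] x(2) \<pi>_surj by auto
    then show ?thesis
      using A.coset_eq_self_iff[OF N_subA, of x] xH by (simp add: A.quotient_zero)
  qed
  moreover have "\<phi> x = \<zero>\<^bsub>E\<^esub>" if "x \<in> N" for x using that N_ker by (auto simp: \<phi>.kernel_eq)
  ultimately show thesis using that[OF \<phi> surj] by blast
qed

section \<open>Isoclinism of two images with the same kernel on the derived algebra\<close>

text \<open>Centrality of an image is tested on brackets, and brackets lie in the derived algebra,
  the only place where the kernel of \<open>h\<close> is prescribed. The criterion therefore depends
  on \<open>N\<close> and not on \<open>h\<close>.\<close>

lemma (in superalgebra_homomorphism) image_in_center_iff: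
  assumes surj: "h ` carrier A = carrier B"
    and ker: "\<And>x. x \<in> derived K A \<Longrightarrow> h x = \<zero>\<^bsub>B\<^esub> \<longleftrightarrow> x \<in> N"
    and x: "x \<in> carrier A"
  shows "h x \<in> lie_center B \<longleftrightarrow> (\<forall>u\<in>carrier A. \<langle>x, u\<rangle>\<^bsub>A\<^esub> \<in> N)"
proof -
  have "h x \<in> lie_center B \<longleftrightarrow> (\<forall>u\<in>carrier A. \<langle>h x, h u\<rangle>\<^bsub>B\<^esub> = \<zero>\<^bsub>B\<^esub>)"
    using h_closed[OF x] by (auto simp: lie_center_def simp flip: surj)
  then show ?thesis
    using x ker dom.bracket_in_derived by (simp flip: h_bracket)
qed

text \<open>The kernels of \<open>\<phi>\<close> and \<open>\<psi>\<close> are compared only on the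
  derived algebra, so \<open>B\<close> and \<open>C\<close> themselves cannot be matched. Modulo the
  centres the two maps have the same fibres, by the criterion for central images.\<close>

lemma central_quotient_iso:
  assumes "superalgebra K A" "lie_superalgebra K B" "lie_superalgebra K C"
    and \<phi>: "\<phi> \<in> superalgebra_hom K A B" "\<phi> ` carrier A = carrier B"
    and \<psi>: "\<psi> \<in> superalgebra_hom K A C" "\<psi> ` carrier A = carrier C"
    and ker: "\<And>x. x \<in> derived K A \<Longrightarrow> \<phi> x = \<zero>\<^bsub>B\<^esub> \<longleftrightarrow> x \<in> N"
      "\<And>x. x \<in> derived K A \<Longrightarrow> \<psi> x = \<zero>\<^bsub>C\<^esub> \<longleftrightarrow> x \<in> N"
  obtains \<alpha> where "\<alpha> \<in> superalgebra_iso K (superalgebra_quotient B (lie_center B))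
      (superalgebra_quotient C (lie_center C))"
    "\<And>x. x \<in> carrier A \<Longrightarrow> \<alpha> (lie_center B +>\<^bsub>B\<^esub> \<phi> x) = lie_center C +>\<^bsub>C\<^esub> \<psi> x"
proof -
  interpret A: superalgebra K A by fact
  interpret B: lie_superalgebra K B by fact
  interpret C: lie_superalgebra K C by fact
  interpret \<phi>: superalgebra_homomorphism K A B \<phi> by unfold_locales (rule \<phi>)
  interpret \<psi>: superalgebra_homomorphism K A C \<psi> by unfold_locales (rule \<psi>)
  let ?QB = "superalgebra_quotient B (lie_center B)" and ?QC = "superalgebra_quotient C (lie_center C)"
  let ?f = "\<lambda>x. lie_center B +>\<^bsub>B\<^esub> \<phi> x" and ?g = "\<lambda>x. lie_center C +>\<^bsub>C\<^esub> \<psi> x"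
  have f: "?f \<in> superalgebra_hom K A ?QB"
    by (rule superalgebra_hom_compose[OF \<phi>(1) B.quotient_hom[OF B.center_ideal]])
  have g: "?g \<in> superalgebra_hom K A ?QC"
    by (rule superalgebra_hom_compose[OF \<psi>(1) C.quotient_hom[OF C.center_ideal]])
  have f_surj: "?f ` carrier A = carrier ?QB"
    unfolding B.quotient_surj[OF B.center_ideal, symmetric] \<phi>(2)[symmetric] by (simp add: image_image)
  have g_surj: "?g ` carrier A = carrier ?QC"
    unfolding C.quotient_surj[OF C.center_ideal, symmetric] \<psi>(2)[symmetric] by (simp add: image_image)
  have part: "part ?QB a \<subseteq> ?f ` part A a" for a
    unfolding B.quotient_part using \<phi>.part_surj[OF \<phi>(2), of a] by blast
  have sub: "submodule (lie_center B) K B" "submodule (lie_center C) K C"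
    using B.center_ideal C.center_ideal by (simp_all add: two_sided_ideal_def)
  have "?f x = ?f y \<longleftrightarrow> ?g x = ?g y" if "x \<in> carrier A" "y \<in> carrier A" for x y
  proof -
    have d: "x \<ominus>\<^bsub>A\<^esub> y \<in> carrier A" using that by simp
    have "?f x = ?f y \<longleftrightarrow> \<phi> (x \<ominus>\<^bsub>A\<^esub> y) \<in> lie_center B"
      using that by (simp add: B.coset_eq_iff[OF sub(1)] \<phi>.h_closed \<phi>.h_diff)
    moreover have "?g x = ?g y \<longleftrightarrow> \<psi> (x \<ominus>\<^bsub>A\<^esub> y) \<in> lie_center C"
      using that by (simp add: C.coset_eq_iff[OF sub(2)] \<psi>.h_closed \<psi>.h_diff)
    ultimately show ?thesis
      using \<phi>.image_in_center_iff[OF \<phi>(2) ker(1) d] \<psi>.image_in_center_iff[OF \<psi>(2) ker(2) d] by blast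
  qed
  then show thesis using A.iso_factor[OF f g f_surj part g_surj] that by metis
qed

text \<open>Differences of elements of the derived algebra stay in it, so there the fibres of both
  maps are the cosets of the same set \<open>N\<close>.\<close>

lemma derived_iso:
  assumes "superalgebra K A" "lie_superalgebra K B" "lie_superalgebra K C"
    and \<phi>: "\<phi> \<in> superalgebra_hom K A B" "\<phi> ` carrier A = carrier B"
    and \<psi>: "\<psi> \<in> superalgebra_hom K A C" "\<psi> ` carrier A = carrier C"
    and ker: "\<And>x. x \<in> derived K A \<Longrightarrow> \<phi> x = \<zero>\<^bsub>B\<^esub> \<longleftrightarrow> x \<in> N"
      "\<And>x. x \<in> derived K A \<Longrightarrow> \<psi> x = \<zero>\<^bsub>C\<^esub> \<longleftrightarrow> x \<in> N"
  obtains \<beta> where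
    "\<beta> \<in> superalgebra_iso K (restrict_to B (derived K B)) (restrict_to C (derived K C))"
    "\<And>x. x \<in> derived K A \<Longrightarrow> \<beta> (\<phi> x) = \<psi> x"
proof -
  interpret A: superalgebra K A by fact
  interpret B: lie_superalgebra K B by fact
  interpret C: lie_superalgebra K C by fact
  interpret \<phi>: superalgebra_homomorphism K A B \<phi> by unfold_locales (rule \<phi>)
  interpret \<psi>: superalgebra_homomorphism K A C \<psi> by unfold_locales (rule \<psi>)
  have im: "\<phi> ` derived K A = derived K B" "\<psi> ` derived K A = derived K C"
    by (rule \<phi>.derived_image[OF assms(2) \<phi>(2)], rule \<psi>.derived_image[OF assms(3) \<psi>(2)])
  let ?A = "restrict_to A (derived K A)" and ?B = "restrict_to B (derived K B)"
    and ?C = "restrict_to C (derived K C)"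
  have carr: "carrier ?A = derived K A" "carrier ?B = derived K B" "carrier ?C = derived K C"
    by (simp_all add: restrict_to_def)
  interpret A': superalgebra K ?A by (rule A.superalgebra_restrict_derived)
  interpret B': superalgebra K ?B by (rule B.superalgebra_restrict_derived)
  have f: "\<phi> \<in> superalgebra_hom K ?A ?B"
    by (rule superalgebra_homI) (auto simp: restrict_to_def A.derived_closed \<phi>.h_add \<phi>.h_smult
        \<phi>.h_bracket \<phi>.h_part simp flip: im)
  have g: "\<psi> \<in> superalgebra_hom K ?A ?C"
    by (rule superalgebra_homI) (auto simp: restrict_to_def A.derived_closed \<psi>.h_add \<psi>.h_smult
        \<psi>.h_bracket \<psi>.h_part simp flip: im)
  interpret f: superalgebra_homomorphism K ?A ?B \<phi> by unfold_locales (rule f)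
  have f_surj: "\<phi> ` carrier ?A = carrier ?B" and g_surj: "\<psi> ` carrier ?A = carrier ?C"
    by (simp_all add: carr im)
  have "\<phi> x = \<phi> y \<longleftrightarrow> \<psi> x = \<psi> y" if "x \<in> carrier ?A" "y \<in> carrier ?A" for x y
  proof -
    have xy: "x \<in> derived K A" "y \<in> derived K A" using that by (simp_all add: carr)
    then have "x \<ominus>\<^bsub>A\<^esub> y \<in> derived K A" by (rule A.submodule_diff[OF A.derived_submodule])
    then show ?thesis
      using \<phi>.h_eq_iff[OF xy[THEN A.derived_closed]] \<psi>.h_eq_iff[OF xy[THEN A.derived_closed]] ker
      by simp
  qed
  then show thesis
    using A'.iso_factor[OF f g f_surj f.part_surj[OF f_surj] g_surj] that carr(1) by metis
qed

theorem corollary3p4: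
  fixes K :: "('a, 'k) ring_scheme"
    and L :: "('a, 'l) superalgebra"
    and X :: "'x set" and d :: "'x \<Rightarrow> bit"
    and F :: "('a, 'f) superalgebra" and p :: "'f \<Rightarrow> 'l"
    and m n :: nat
    and C\<^sub>1 :: "('a, 'c) superalgebra"
    and C\<^sub>2 :: "('a, 'e) superalgebra"
  assumes "field K"
    and "[(2::nat)] \<cdot>\<^bsub>K\<^esub> \<one>\<^bsub>K\<^esub> \<noteq> \<zero>\<^bsub>K\<^esub>" and "[(3::nat)] \<cdot>\<^bsub>K\<^esub> \<one>\<^bsub>K\<^esub> \<noteq> \<zero>\<^bsub>K\<^esub>"
    and "lie_superalgebra K L"
    and "is_free_presentation K X d F p L"
    and "has_superdim K (schur_multiplier K F p L) m n"
    and "is_cover K (schur_multiplier K F p L) C\<^sub>1 L"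
    and "is_cover K (schur_multiplier K F p L) C\<^sub>2 L"
  shows "isoclinic K C\<^sub>1 C\<^sub>2"
proof -
  note pres = assms(5) and dim = assms(6)
  obtain f1 where cover1: "is_stem_cover K (schur_multiplier K F p L) C\<^sub>1 f1 L"
    using assms(7) unfolding is_cover_def by blast
  obtain f2 where cover2: "is_stem_cover K (schur_multiplier K F p L) C\<^sub>2 f2 L"
    using assms(8) unfolding is_cover_def by blast
  define N where "N = bracket_span K F (carrier F) (a_kernel F L p)"
  obtain \<phi>1 where \<phi>1: "\<phi>1 \<in> superalgebra_hom K F C\<^sub>1" and surj1: "\<phi>1 ` carrier F = carrier C\<^sub>1"
    and ker1: "\<And>x. x \<in> derived K F \<Longrightarrow> \<phi>1 x = \<zero>\<^bsub>C\<^sub>1\<^esub> \<longleftrightarrow> x \<in> N"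
    using stem_cover_lift[OF pres dim cover1] unfolding N_def by metis
  obtain \<phi>2 where \<phi>2: "\<phi>2 \<in> superalgebra_hom K F C\<^sub>2" and surj2: "\<phi>2 ` carrier F = carrier C\<^sub>2"
    and ker2: "\<And>x. x \<in> derived K F \<Longrightarrow> \<phi>2 x = \<zero>\<^bsub>C\<^sub>2\<^esub> \<longleftrightarrow> x \<in> N"
    using stem_cover_lift[OF pres dim cover2] unfolding N_def by metis
  have C1: "lie_superalgebra K C\<^sub>1"
    using cover1 unfolding is_stem_cover_def is_stem_extension_def is_extension_def by blast
  have C2: "lie_superalgebra K C\<^sub>2"
    using cover2 unfolding is_stem_cover_def is_stem_extension_def is_extension_def by blast
  interpret F: lie_superalgebra K F
    using pres unfolding is_free_presentation_def is_extension_def by blast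
  interpret C1: lie_superalgebra K C\<^sub>1 by (rule C1)
  interpret C2: lie_superalgebra K C\<^sub>2 by (rule C2)

  obtain \<alpha> where \<alpha>: "\<alpha> \<in> superalgebra_iso K (superalgebra_quotient C\<^sub>1 (lie_center C\<^sub>1))
      (superalgebra_quotient C\<^sub>2 (lie_center C\<^sub>2))"
    and \<alpha>_eq: "\<And>x. x \<in> carrier F \<Longrightarrow>
      \<alpha> (lie_center C\<^sub>1 +>\<^bsub>C\<^sub>1\<^esub> \<phi>1 x) = lie_center C\<^sub>2 +>\<^bsub>C\<^sub>2\<^esub> \<phi>2 x"
    using central_quotient_iso[OF F.superalgebra_axioms C1 C2 \<phi>1 surj1 \<phi>2 surj2 ker1 ker2] by metis
  obtain \<beta> where \<beta>: "\<beta> \<in> superalgebra_iso K (restrict_to C\<^sub>1 (derived K C\<^sub>1)) (restrict_to C\<^sub>2 (derived K C\<^sub>2))"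
    and \<beta>_eq: "\<And>x. x \<in> derived K F \<Longrightarrow> \<beta> (\<phi>1 x) = \<phi>2 x"
    using derived_iso[OF F.superalgebra_axioms C1 C2 \<phi>1 surj1 \<phi>2 surj2 ker1 ker2] by metis

  \<comment> \<open>Choose preimages \<open>x\<close> and \<open>y\<close> of \<open>l\<close> and
    \<open>m\<close> in \<open>F\<close>. By the formula for \<open>\<alpha>\<close>, the elements
    \<open>k\<close> and \<open>r\<close> are \<open>\<phi>2 x\<close> and \<open>\<phi>2 y\<close>
    up to central terms, which do not affect the bracket, and \<open>\<beta>\<close> carries the
    image of the bracket of \<open>x\<close> and \<open>y\<close> under \<open>\<phi>1\<close> to
    its image under \<open>\<phi>2\<close>.\<close>
  have "\<beta> \<langle>l, m\<rangle>\<^bsub>C\<^sub>1\<^esub> = \<langle>k, r\<rangle>\<^bsub>C\<^sub>2\<^esub>"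
    if "l \<in> carrier C\<^sub>1" "m \<in> carrier C\<^sub>1" and k: "k \<in> carrier C\<^sub>2" and r: "r \<in> carrier C\<^sub>2"
      and lk: "lie_center C\<^sub>2 +>\<^bsub>C\<^sub>2\<^esub> k = \<alpha> (lie_center C\<^sub>1 +>\<^bsub>C\<^sub>1\<^esub> l)"
      and mr: "lie_center C\<^sub>2 +>\<^bsub>C\<^sub>2\<^esub> r = \<alpha> (lie_center C\<^sub>1 +>\<^bsub>C\<^sub>1\<^esub> m)" for l m k r
  proof -
    obtain x where x: "x \<in> carrier F" "l = \<phi>1 x"
      using \<open>l \<in> carrier C\<^sub>1\<close> unfolding surj1[symmetric] by blast
    obtain y where y: "y \<in> carrier F" "m = \<phi>1 y"
      using \<open>m \<in> carrier C\<^sub>1\<close> unfolding surj1[symmetric] by blast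
    note c = hom_closed[OF \<phi>2 x(1)] hom_closed[OF \<phi>2 y(1)]
    have center: "submodule (lie_center C\<^sub>2) K C\<^sub>2"
      using C2.center_ideal by (simp add: two_sided_ideal_def)
    have kx: "k \<ominus>\<^bsub>C\<^sub>2\<^esub> \<phi>2 x \<in> lie_center C\<^sub>2"
      using lk \<alpha>_eq[OF x(1)] x(2) C2.coset_eq_iff[OF center k c(1)] by simp
    have ry: "r \<ominus>\<^bsub>C\<^sub>2\<^esub> \<phi>2 y \<in> lie_center C\<^sub>2"
      using mr \<alpha>_eq[OF y(1)] y(2) C2.coset_eq_iff[OF center r c(2)] by simp
    have "\<langle>k, r\<rangle>\<^bsub>C\<^sub>2\<^esub> = \<langle>\<phi>2 x, r\<rangle>\<^bsub>C\<^sub>2\<^esub>"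
      using C2.bracket_diff_left[OF k c(1) r] kx r
        C2.diff_eq_zero_iff[OF C2.bracket_closed[OF k r] C2.bracket_closed[OF c(1) r]]
      by (simp add: lie_center_def)
    also have "\<dots> = \<langle>\<phi>2 x, \<phi>2 y\<rangle>\<^bsub>C\<^sub>2\<^esub>"
      using C2.bracket_diff_right[OF c(1) r c(2)] C2.center_bracket_right[OF ry c(1)]
        C2.diff_eq_zero_iff[OF C2.bracket_closed[OF c(1) r] C2.bracket_closed[OF c]]
      by simp
    also have "\<dots> = \<phi>2 \<langle>x, y\<rangle>\<^bsub>F\<^esub>" using hom_bracket[OF \<phi>2 x(1) y(1)] by simp
    also have "\<dots> = \<beta> (\<phi>1 \<langle>x, y\<rangle>\<^bsub>F\<^esub>)"
      using \<beta>_eq[OF F.bracket_in_derived[OF x(1) y(1)]] by simp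
    also have "\<dots> = \<beta> \<langle>l, m\<rangle>\<^bsub>C\<^sub>1\<^esub>" using hom_bracket[OF \<phi>1 x(1) y(1)] x(2) y(2) by simp
    finally show ?thesis by simp
  qed
  then show ?thesis unfolding isoclinic_def using \<alpha> \<beta> by blast
qed

end
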